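(* Let $\Omega=\{\mathbf a_1,\dots,\mathbf a_k\}\subseteq\mathbb F^n$ be a finite set of $k\ge 1$ distinct points, let $(m_1,\dots,m_k)\in\mathcal M^k$, and put $N:=\sum_{j=1}^k(\deg(m_j)+1)$. (Left version.) The following conditions are equivalent: 1) $\Omega$ is left DP-independent of type $(m_1,\dots,m_k)$; 2) there exist $F_1,\dots,F_N\in\mathcal R$ with $\deg(F_i)<N$ for all $i$ such that the map $\psi:\langle F_1,\dots,F_N\rangle\to\mathbb F^N$ from the left $\mathbb F$-submodule of $\mathcal R$ generated by $F_1,\dots,F_N$, sending $F$ to the vector whose entries are $(\Delta_{\mathbf a_j}^{m_j^{(i)}}F)(\mathbf a_j)$, $1\le j\le k$, $0\le i\le\deg(m_j)$ (ordered first by $j$, then by $i$), is an isomorphism of left $\mathbb F$-modules; 3) for every family $(b_{j,i})_{1\le j\le k,\,0\le i\le\deg(m_j)}$ of $N$ values in $\mathbb F$ there exists $F\in\mathcal R$ with $\deg(F)<N$ such that $(\Delta_{\mathbf a_j}^{m_j^{(i)}}F)(\mathbf a_j)=b_{j,i}$ for all $j=1,\dots,k$ and $i=0,\dots,\deg(m_j)$. (Right version.) Assume that $\varphi$ is an isomorphism of additive groups. The following conditions are equivalent: 1) $\Omega$ is right DP-independent of type $(m_1,\dots,m_k)$; 2) there exist $F_1,\dots,F_N\in\mathcal R$ with $\deg(F_i)<N$ for all $i$ such that the map $\psi_L:\langle F_1,\dots,F_N\rangle_L\to\mathbb F^N$ from the right $\mathbb F$-submodule of $\mathcal R$ generated by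 $F_1,\dots,F_N$, sending $F$ to the vector whose entries are $(\Delta_{\mathbf a_j,L}^{m_j^{[i]}}F)_L(\mathbf a_j)$, $1\le j\le k$, $0\le i\le\deg(m_j)$, is an isomorphism of right $\mathbb F$-modules; 3) for every family $(b_{j,i})_{1\le j\le k,\,0\le i\le\deg(m_j)}$ of $N$ values in $\mathbb F$ there exists $F\in\mathcal R$ with $\deg(F)<N$ such that $(\Delta_{\mathbf a_j,L}^{m_j^{[i]}}F)_L(\mathbf a_j)=b_{j,i}$ for all $j=1,\dots,k$ and $i=0,\dots,\deg(m_j)$.
   Context: $\mathbb F$ is a division ring, $n\ge1$, $\sigma=(\sigma_{i,j}):\mathbb F\to\mathbb F^{n\times n}$ is a (unital) ring homomorphism and $\delta={}^t(\delta_1,\dots,\delta_n):\mathbb F\to\mathbb F^{n\times1}$ is a $\sigma$-vector derivation, i.e. additive with $\delta(ab)=\sigma(a)\delta(b)+\delta(a)b$. $\mathcal M$ is the free monoid on $x_1,\dots,x_n$, with empty word $o$ (identified with $1$); $\deg m$ is the word length. $\mathcal R=\mathbb F[\mathbf x;\sigma,\delta]$ is the free left $\mathbb F$-module with basis $\mathcal M$, with the ring multiplication that concatenates monomials and satisfies $x_i a=\sum_j\sigma_{i,j}(a)x_j+\delta_i(a)$ for $a\in\mathbb F$. $\deg F$ is the maximal degree of a monomial with nonzero coefficient in $F$, and $\deg 0=-\infty$. Define $\varphi:\mathbb F^n\to\mathbb F^n$ by $\varphi(\gamma_1,\dots,\gamma_n)=\big(\sum_j\sigma_{j,1}(\gamma_j),\dots,\sum_j\sigma_{j,n}(\gamma_j)\big)$,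 an additive homomorphism. Right evaluation and derivatives: for $\mathbf a=(a_1,\dots,a_n)\in\mathbb F^n$ every $F\in\mathcal R$ is uniquely $F=\sum_i(\Delta_{\mathbf a}^{x_i}F)\,(x_i-a_i)+F(\mathbf a)$ with $\Delta_{\mathbf a}^{x_i}F\in\mathcal R$, $F(\mathbf a)\in\mathbb F$. Left ones (when $\varphi$ is bijective): every $F$ is uniquely $F=\sum_i(x_i-a_i)\,(\Delta_{\mathbf a,L}^{x_i}F)+F_L(\mathbf a)$ with $\Delta_{\mathbf a,L}^{x_i}F\in\mathcal R$, $F_L(\mathbf a)\in\mathbb F$. For $m=x_{i_1}\cdots x_{i_s}$: $\Delta_{\mathbf a}^mF=\Delta_{\mathbf a}^{x_{i_1}}(\Delta_{\mathbf a}^{x_{i_2}}(\cdots\Delta_{\mathbf a}^{x_{i_s}}F))$ and $\Delta_{\mathbf a,L}^mF=\Delta_{\mathbf a,L}^{x_{i_s}}(\Delta_{\mathbf a,L}^{x_{i_{s-1}}}(\cdots\Delta_{\mathbf a,L}^{x_{i_1}}F))$; $\Delta^o_{\mathbf a}F=\Delta^o_{\mathbf a,L}F=F$. $(\Delta_{\mathbf a}^mF)(\mathbf a)$ and $(\Delta_{\mathbf a,L}^mF)_L(\mathbf a)$ are the right, respectively left, evaluations at $\mathbf a$ of these polynomials. For $m=x_{j_s}\cdots x_{j_2}x_{j_1}\in\mathcal M$ and $0\le i\le s$ write $m^{(i)}:=x_{j_i}\cdots x_{j_1}$ (suffix of length $i$) and $m^{[i]}:=x_{j_s}\cdots x_{j_{s-i+1}}$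 (prefix of length $i$), with $m^{(0)}=m^{[0]}=o$. For a finite set $\Omega=\{\mathbf a_1,\dots,\mathbf a_k\}$ and $\vec m=(m_1,\dots,m_k)\in\mathcal M^k$: $I^{\vec m}(\Omega)$ is the set of $F\in\mathcal R$ with $(\Delta_{\mathbf a_j}^{m_j^{(i)}}F)(\mathbf a_j)=0$ for all $j$ and $0\le i\le\deg m_j$; $I^{\vec m}_L(\Omega)$ is the set of $F$ with $(\Delta_{\mathbf a_j,L}^{m_j^{[i]}}F)_L(\mathbf a_j)=0$ for all $j$ and $0\le i\le\deg m_j$. For $\Omega=\emptyset$ both are $\mathcal R$. DP-independence: for $m'\in\mathcal M$ of degree $t$, a point $\mathbf a\in\mathbb F^n\setminus\Omega$ is left DP-independent of type $(\vec m,m')$ from $\Omega$ if $I^{\vec m}(\Omega)\supsetneq I^{\vec m,m'^{(0)}}(\Omega\cup\{\mathbf a\})\supsetneq I^{\vec m,m'^{(1)}}(\Omega\cup\{\mathbf a\})\supsetneq\cdots\supsetneq I^{\vec m,m'^{(t)}}(\Omega\cup\{\mathbf a\})$, and right DP-independent of type $(\vec m,m')$ from $\Omega$ if the same strict chain holds with every $I$ replaced by $I_L$ and every suffix $m'^{(i)}$ by the prefix $m'^{[i]}$. $\Omega$ is left (right) DP-independent of type $(m_1,\dots,m_k)$ if for every $j$ the point $\mathbf a_j$ is left (right) DP-independent of type $((m_1,\dots,m_{j-1},m_{j+1},\dots,m_k),m_j)$ from $\Omega\setminus\{\mathbf a_j\}$. *)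

theory Defs
  imports "HOL-Analysis.Analysis" "HOL-Library.Poly_Mapping"
begin

text \<open>
  The variables are indexed by a finite type; words, i.e. elements of the free monoid, are
  lists of indices, with \<open>[]\<close> the empty word.  A skew polynomial is the finitely supported
  family of its left coefficients.
\<close>

type_synonym ('a, 'n) skew_poly = "'n list \<Rightarrow>\<^sub>0 'a"

abbreviation coef :: "('a::zero, 'n) skew_poly \<Rightarrow> 'n list \<Rightarrow> 'a" where
  "coef \<equiv> Poly_Mapping.lookup"

definition matrix_ring_hom :: "('a::division_ring \<Rightarrow> 'a ^ 'n::finite ^ 'n) \<Rightarrow> bool" where
  "matrix_ring_hom \<sigma> \<longleftrightarrow>
     \<sigma> 1 = mat 1 \<and> (\<forall>a b. \<sigma> (a + b) = \<sigma> a + \<sigma> b) \<and> (\<forall>a b. \<sigma> (a * b) = \<sigma> a ** \<sigma> b)"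

definition vector_derivation ::
  "('a::division_ring \<Rightarrow> 'a ^ 'n::finite ^ 'n) \<Rightarrow> ('a \<Rightarrow> 'a ^ 'n) \<Rightarrow> bool" where
  "vector_derivation \<sigma> \<delta> \<longleftrightarrow>
     (\<forall>a b. \<delta> (a + b) = \<delta> a + \<delta> b) \<and> (\<forall>a b. \<delta> (a * b) = \<sigma> a *v \<delta> b + (\<chi> i. \<delta> a $ i * b))"

definition phi :: "('a::division_ring \<Rightarrow> 'a ^ 'n::finite ^ 'n) \<Rightarrow> 'a ^ 'n \<Rightarrow> 'a ^ 'n" where
  "phi \<sigma> \<gamma> = (\<chi> i. \<Sum>j\<in>UNIV. \<sigma> (\<gamma> $ j) $ j $ i)"

definition additive_iso :: "('a::ab_group_add \<Rightarrow> 'b::ab_group_add) \<Rightarrow> bool" where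
  "additive_iso f \<longleftrightarrow> bij f \<and> (\<forall>x y. f (x + y) = f x + f y)"

definition skew_deg :: "('a::zero, 'n) skew_poly \<Rightarrow> ereal" where
  "skew_deg F = (if F = 0 then -\<infinity> else ereal (real (Max (length ` Poly_Mapping.keys F))))"

definition skew_const :: "'a::zero \<Rightarrow> ('a, 'n) skew_poly" where
  "skew_const a = Poly_Mapping.single [] a"

definition skew_var :: "'n \<Rightarrow> ('a::zero_neq_one, 'n) skew_poly" where
  "skew_var i = Poly_Mapping.single [i] 1"

definition lscale :: "'a::division_ring \<Rightarrow> ('a, 'n) skew_poly \<Rightarrow> ('a, 'n) skew_poly" where
  "lscale c F = Poly_Mapping.map ((*) c) F"


subsection \<open>Definitions depending on the skew data\<close>

context
  fixes \<sigma> :: "'a::division_ring \<Rightarrow> 'a ^ 'n::finite ^ 'n" and \<delta> :: "'a \<Rightarrow> 'a ^ 'n"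
begin

text \<open>
  The product is computed from the rule \<open>x\<^sub>i a = (\<Sum>j. \<sigma>\<^sub>i\<^sub>j(a) x\<^sub>j) + \<delta>\<^sub>i(a)\<close>: first left
  multiplication by a variable, then by a word, then by a general skew polynomial.  The ring laws
  and the defining relations are proved below.
\<close>

definition var_mult :: "'n \<Rightarrow> ('a, 'n) skew_poly \<Rightarrow> ('a, 'n) skew_poly" where
  "var_mult i G = (\<Sum>m\<in>Poly_Mapping.keys G.
     (\<Sum>j\<in>UNIV. Poly_Mapping.single (j # m) (\<sigma> (coef G m) $ i $ j))
       + Poly_Mapping.single m (\<delta> (coef G m) $ i))"

definition word_mult :: "'n list \<Rightarrow> ('a, 'n) skew_poly \<Rightarrow> ('a, 'n) skew_poly" where
  "word_mult w G = foldr var_mult w G"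

definition skew_mult ::
  "('a, 'n) skew_poly \<Rightarrow> ('a, 'n) skew_poly \<Rightarrow> ('a, 'n) skew_poly" (infixl \<open>\<odot>\<close> 70) where
  "F \<odot> G = (\<Sum>m\<in>Poly_Mapping.keys F. lscale (coef F m) (word_mult m G))"

text \<open>
  Right and left division by the \<open>x\<^sub>i - a\<^sub>i\<close>, returning the family of quotients and the remainder.
  The definite descriptions are justified by \<open>right_division_unique\<close> and
  \<open>left_division_unique\<close> (the latter for bijective \<open>phi \<sigma>\<close>) below.
\<close>

definition right_division ::
  "'a ^ 'n \<Rightarrow> ('a, 'n) skew_poly \<Rightarrow> ('n \<Rightarrow> ('a, 'n) skew_poly) \<times> 'a" where
  "right_division a F =
     (THE (D, c). F = (\<Sum>i\<in>UNIV. D i \<odot> (skew_var i - skew_const (a $ i))) + skew_const c)"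

definition left_division ::
  "'a ^ 'n \<Rightarrow> ('a, 'n) skew_poly \<Rightarrow> ('n \<Rightarrow> ('a, 'n) skew_poly) \<times> 'a" where
  "left_division a F =
     (THE (D, c). F = (\<Sum>i\<in>UNIV. (skew_var i - skew_const (a $ i)) \<odot> D i) + skew_const c)"

definition right_eval :: "('a, 'n) skew_poly \<Rightarrow> 'a ^ 'n \<Rightarrow> 'a" where
  "right_eval F a = snd (right_division a F)"

definition left_eval :: "('a, 'n) skew_poly \<Rightarrow> 'a ^ 'n \<Rightarrow> 'a" where
  "left_eval F a = snd (left_division a F)"

text \<open>
  For \<open>m = x\<^sub>i\<^sub>1 \<dots> x\<^sub>i\<^sub>s\<close>, the right derivative applies the last letter first, the left one the
  first letter first.
\<close>

definition right_deriv :: "'a ^ 'n \<Rightarrow> 'n list \<Rightarrow> ('a, 'n) skew_poly \<Rightarrow> ('a, 'n) skew_poly" where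
  "right_deriv a m F = foldr (\<lambda>i G. fst (right_division a G) i) m F"

definition left_deriv :: "'a ^ 'n \<Rightarrow> 'n list \<Rightarrow> ('a, 'n) skew_poly \<Rightarrow> ('a, 'n) skew_poly" where
  "left_deriv a m F = fold (\<lambda>i G. fst (left_division a G) i) m F"

end

definition word_suffix :: "nat \<Rightarrow> 'n list \<Rightarrow> 'n list" where
  "word_suffix i m = drop (length m - i) m"

definition word_prefix :: "nat \<Rightarrow> 'n list \<Rightarrow> 'n list" where
  "word_prefix i m = take i m"

definition delete_nth :: "nat \<Rightarrow> 'b list \<Rightarrow> 'b list" where
  "delete_nth j xs = take j xs @ drop (Suc j) xs"

context
  fixes \<sigma> :: "'a::division_ring \<Rightarrow> 'a ^ 'n::finite ^ 'n" and \<delta> :: "'a \<Rightarrow> 'a ^ 'n"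
begin

text \<open>
  A finite set of points with words attached is given by a list \<open>ps\<close> of points and a list \<open>ms\<close>
  of words of the same length.
\<close>

definition vanish_left :: "'n list list \<Rightarrow> ('a ^ 'n) list \<Rightarrow> ('a, 'n) skew_poly set" where
  "vanish_left ms ps = {F. \<forall>j<length ps. \<forall>i\<le>length (ms ! j).
     right_eval \<sigma> \<delta> (right_deriv \<sigma> \<delta> (ps ! j) (word_suffix i (ms ! j)) F) (ps ! j) = 0}"

definition vanish_right :: "'n list list \<Rightarrow> ('a ^ 'n) list \<Rightarrow> ('a, 'n) skew_poly set" where
  "vanish_right ms ps = {F. \<forall>j<length ps. \<forall>i\<le>length (ms ! j).
     left_eval \<sigma> \<delta> (left_deriv \<sigma> \<delta> (ps ! j) (word_prefix i (ms ! j)) F) (ps ! j) = 0}"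

definition left_DP_indep_from ::
  "'n list list \<Rightarrow> 'n list \<Rightarrow> 'a ^ 'n \<Rightarrow> ('a ^ 'n) list \<Rightarrow> bool" where
  "left_DP_indep_from ms m a ps \<longleftrightarrow>
     a \<notin> set ps \<and>
     vanish_left (ms @ [word_suffix 0 m]) (ps @ [a]) \<subset> vanish_left ms ps \<and>
     (\<forall>i<length m. vanish_left (ms @ [word_suffix (Suc i) m]) (ps @ [a])
                     \<subset> vanish_left (ms @ [word_suffix i m]) (ps @ [a]))"

definition right_DP_indep_from ::
  "'n list list \<Rightarrow> 'n list \<Rightarrow> 'a ^ 'n \<Rightarrow> ('a ^ 'n) list \<Rightarrow> bool" where
  "right_DP_indep_from ms m a ps \<longleftrightarrow>
     a \<notin> set ps \<and>
     vanish_right (ms @ [word_prefix 0 m]) (ps @ [a]) \<subset> vanish_right ms ps \<and>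
     (\<forall>i<length m. vanish_right (ms @ [word_prefix (Suc i) m]) (ps @ [a])
                     \<subset> vanish_right (ms @ [word_prefix i m]) (ps @ [a]))"

definition left_DP_indep :: "'n list list \<Rightarrow> ('a ^ 'n) list \<Rightarrow> bool" where
  "left_DP_indep ms ps \<longleftrightarrow>
     (\<forall>j<length ps. left_DP_indep_from (delete_nth j ms) (ms ! j) (ps ! j) (delete_nth j ps))"

definition right_DP_indep :: "'n list list \<Rightarrow> ('a ^ 'n) list \<Rightarrow> bool" where
  "right_DP_indep ms ps \<longleftrightarrow>
     (\<forall>j<length ps. right_DP_indep_from (delete_nth j ms) (ms ! j) (ps ! j) (delete_nth j ps))"

text \<open>
  Vectors with \<open>N\<close> entries are lists of length \<open>N\<close>; the entries below are ordered first by the point, then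
  by the length of the suffix (prefix).
\<close>

definition psi_left :: "'n list list \<Rightarrow> ('a ^ 'n) list \<Rightarrow> ('a, 'n) skew_poly \<Rightarrow> 'a list" where
  "psi_left ms ps F = concat (map (\<lambda>j. map (\<lambda>i.
       right_eval \<sigma> \<delta> (right_deriv \<sigma> \<delta> (ps ! j) (word_suffix i (ms ! j)) F) (ps ! j))
     [0..<Suc (length (ms ! j))]) [0..<length ps])"

definition psi_right :: "'n list list \<Rightarrow> ('a ^ 'n) list \<Rightarrow> ('a, 'n) skew_poly \<Rightarrow> 'a list" where
  "psi_right ms ps F = concat (map (\<lambda>j. map (\<lambda>i.
       left_eval \<sigma> \<delta> (left_deriv \<sigma> \<delta> (ps ! j) (word_prefix i (ms ! j)) F) (ps ! j))
     [0..<Suc (length (ms ! j))]) [0..<length ps])"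

definition left_submodule :: "('a, 'n) skew_poly set \<Rightarrow> bool" where
  "left_submodule S \<longleftrightarrow> 0 \<in> S \<and> (\<forall>F\<in>S. \<forall>G\<in>S. F + G \<in> S) \<and>
     (\<forall>c. \<forall>F\<in>S. skew_mult \<sigma> \<delta> (skew_const c) F \<in> S)"

definition right_submodule :: "('a, 'n) skew_poly set \<Rightarrow> bool" where
  "right_submodule S \<longleftrightarrow> 0 \<in> S \<and> (\<forall>F\<in>S. \<forall>G\<in>S. F + G \<in> S) \<and>
     (\<forall>c. \<forall>F\<in>S. skew_mult \<sigma> \<delta> F (skew_const c) \<in> S)"

definition left_module_iso ::
  "nat \<Rightarrow> ('a, 'n) skew_poly set \<Rightarrow> (('a, 'n) skew_poly \<Rightarrow> 'a list) \<Rightarrow> bool" where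
  "left_module_iso N S f \<longleftrightarrow>
     bij_betw f S {v. length v = N} \<and>
     (\<forall>F\<in>S. \<forall>G\<in>S. f (F + G) = map2 (+) (f F) (f G)) \<and>
     (\<forall>c. \<forall>F\<in>S. f (skew_mult \<sigma> \<delta> (skew_const c) F) = map (\<lambda>v. c * v) (f F))"

definition right_module_iso ::
  "nat \<Rightarrow> ('a, 'n) skew_poly set \<Rightarrow> (('a, 'n) skew_poly \<Rightarrow> 'a list) \<Rightarrow> bool" where
  "right_module_iso N S f \<longleftrightarrow>
     bij_betw f S {v. length v = N} \<and>
     (\<forall>F\<in>S. \<forall>G\<in>S. f (F + G) = map2 (+) (f F) (f G)) \<and>
     (\<forall>c. \<forall>F\<in>S. f (skew_mult \<sigma> \<delta> F (skew_const c)) = map (\<lambda>v. v * c) (f F))"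

end


subsection \<open>Ring laws and the division theorems\<close>

lemma coef_lscale: "coef (lscale c F) m = c * coef F m"
  by (cases "coef F m = 0") (auto simp: lscale_def Poly_Mapping.map.rep_eq when_def)

lemma lscale_simps [simp]:
  "lscale c 0 = 0" "lscale 0 F = 0" "lscale 1 F = F"
  "lscale c (Poly_Mapping.single m a) = Poly_Mapping.single m (c * a)"
  by (auto intro!: poly_mapping_eqI simp: coef_lscale lookup_single when_def)

lemma lscale_add: "lscale c (F + G) = lscale c F + lscale c G"
  by (rule poly_mapping_eqI) (simp add: coef_lscale lookup_add algebra_simps)

lemma lscale_add_left: "lscale (c + d) F = lscale c F + lscale d F"
  by (rule poly_mapping_eqI) (simp add: coef_lscale lookup_add algebra_simps)

lemma lscale_lscale: "lscale c (lscale d F) = lscale (c * d) F"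
  by (rule poly_mapping_eqI) (simp add: coef_lscale mult.assoc)

lemma lscale_sum: "lscale c (sum f A) = (\<Sum>x\<in>A. lscale c (f x))"
  by (induction A rule: infinite_finite_induct) (auto simp: lscale_add)

lemma lscale_sum_left: "lscale (sum f A) F = (\<Sum>x\<in>A. lscale (f x) F)"
  by (induction A rule: infinite_finite_induct) (auto simp: lscale_add_left)

lemma skew_poly_expand: "F = (\<Sum>m\<in>Poly_Mapping.keys F. Poly_Mapping.single m (coef F m))"
proof (rule poly_mapping_eqI)
  fix k
  have "coef (\<Sum>m\<in>Poly_Mapping.keys F. Poly_Mapping.single m (coef F m)) k
      = (\<Sum>m\<in>Poly_Mapping.keys F. if m = k then coef F m else 0)"
    by (simp add: lookup_sum lookup_single when_def)
  also have "\<dots> = coef F k"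
    by (simp add: in_keys_iff)
  finally show "coef F k = coef (\<Sum>m\<in>Poly_Mapping.keys F. Poly_Mapping.single m (coef F m)) k" ..
qed

lemma skew_poly_induct [case_names zero single add]:
  fixes F :: "('a::division_ring, 'n) skew_poly"
  assumes "P 0" "\<And>m c. m \<in> Poly_Mapping.keys F \<Longrightarrow> P (Poly_Mapping.single m c)" "\<And>F G. P F \<Longrightarrow> P G \<Longrightarrow> P (F + G)"
  shows "P F"
proof -
  have "P (\<Sum>m\<in>A. Poly_Mapping.single m (coef F m))" if "finite A" "A \<subseteq> Poly_Mapping.keys F" for A
    using that by (induction A rule: finite_induct) (auto intro: assms)
  from this[of "Poly_Mapping.keys F"] show ?thesis
    using skew_poly_expand[of F] by simp
qed

lemma phi_add:
  assumes "matrix_ring_hom \<sigma>"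
  shows "phi \<sigma> (x + y) = phi \<sigma> x + phi \<sigma> y"
  using assms by (simp add: phi_def matrix_ring_hom_def vec_eq_iff sum.distrib)

context
  fixes \<sigma> :: "'a::division_ring \<Rightarrow> 'a ^ 'n::finite ^ 'n" and \<delta> :: "'a \<Rightarrow> 'a ^ 'n"
  assumes hom: "matrix_ring_hom \<sigma>" and der: "vector_derivation \<sigma> \<delta>"
begin

private abbreviation smult (infixl \<open>\<odot>\<close> 70) where "F \<odot> G \<equiv> skew_mult \<sigma> \<delta> F G"

lemma sigma_delta_simps:
  "\<sigma> 0 = 0" "\<delta> 0 = 0" "\<sigma> 1 = mat 1" "\<delta> 1 = 0"
  "\<sigma> (a + b) = \<sigma> a + \<sigma> b" "\<delta> (a + b) = \<delta> a + \<delta> b"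
  "\<sigma> (a * b) $ i $ j = (\<Sum>k\<in>UNIV. \<sigma> a $ i $ k * \<sigma> b $ k $ j)"
  "\<delta> (a * b) $ i = (\<Sum>k\<in>UNIV. \<sigma> a $ i $ k * \<delta> b $ k) + \<delta> a $ i * b"
proof -
  have h: "\<sigma> (a + b) = \<sigma> a + \<sigma> b" "\<sigma> 1 = mat 1" "\<sigma> (a * b) = \<sigma> a ** \<sigma> b" for a b
    using hom by (auto simp: matrix_ring_hom_def)
  have d: "\<delta> (a + b) = \<delta> a + \<delta> b" "\<delta> (a * b) = \<sigma> a *v \<delta> b + (\<chi> i. \<delta> a $ i * b)" for a b
    using der by (auto simp: vector_derivation_def)
  show "\<sigma> 0 = 0" "\<delta> 0 = 0" using h(1)[of 0 0] d(1)[of 0 0] by simp_all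
  show "\<delta> 1 = 0" using d(2)[of 1 1] by (simp add: h matrix_vector_mul_lid)
  show "\<sigma> 1 = mat 1" "\<sigma> (a + b) = \<sigma> a + \<sigma> b" "\<delta> (a + b) = \<delta> a + \<delta> b" by (fact h d)+
  show "\<sigma> (a * b) $ i $ j = (\<Sum>k\<in>UNIV. \<sigma> a $ i $ k * \<sigma> b $ k $ j)"
    by (simp add: h matrix_matrix_mult_def)
  show "\<delta> (a * b) $ i = (\<Sum>k\<in>UNIV. \<sigma> a $ i $ k * \<delta> b $ k) + \<delta> a $ i * b"
    by (simp add: d matrix_vector_mult_def)
qed

lemma var_mult_0 [simp]: "var_mult \<sigma> \<delta> i 0 = 0"
  by (simp add: var_mult_def)

lemma var_mult_single: "var_mult \<sigma> \<delta> i (Poly_Mapping.single m c) =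
    (\<Sum>j\<in>UNIV. Poly_Mapping.single (j # m) (\<sigma> c $ i $ j)) + Poly_Mapping.single m (\<delta> c $ i)"
  by (cases "c = 0") (simp_all add: var_mult_def sigma_delta_simps)

lemma var_mult_add: "var_mult \<sigma> \<delta> i (F + G) = var_mult \<sigma> \<delta> i F + var_mult \<sigma> \<delta> i G"
  unfolding var_mult_def
  by (rule setsum_keys_plus_distrib)
     (simp_all add: sigma_delta_simps single_add sum.distrib algebra_simps)

lemma var_mult_sum: "var_mult \<sigma> \<delta> i (sum f A) = (\<Sum>x\<in>A. var_mult \<sigma> \<delta> i (f x))"
  by (induction A rule: infinite_finite_induct) (auto simp: var_mult_add)

lemma var_mult_lscale: "var_mult \<sigma> \<delta> i (lscale c G) =
    (\<Sum>j\<in>UNIV. lscale (\<sigma> c $ i $ j) (var_mult \<sigma> \<delta> j G)) + lscale (\<delta> c $ i) G"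
proof (induction G rule: skew_poly_induct)
  case (single m d)
  have single_sum: "Poly_Mapping.single k (sum f A) = (\<Sum>x\<in>A. Poly_Mapping.single k (f x))"
    for k :: "'n list" and f :: "'n \<Rightarrow> 'a" and A
    by (induction A rule: infinite_finite_induct) (auto simp: single_add)
  have "(\<Sum>j\<in>UNIV. \<Sum>k\<in>UNIV. Poly_Mapping.single (j # m) (\<sigma> c $ i $ k * \<sigma> d $ k $ j))
      = (\<Sum>k\<in>UNIV. \<Sum>j\<in>UNIV. Poly_Mapping.single (j # m) (\<sigma> c $ i $ k * \<sigma> d $ k $ j))"
    by (rule sum.swap)
  then show ?case
    by (simp add: var_mult_single sigma_delta_simps lscale_add lscale_sum single_add single_sum
        sum.distrib add.assoc)
next
  case (add F G)
  then show ?case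
    by (simp add: lscale_add var_mult_add sum.distrib algebra_simps)
qed auto

lemma word_mult_simps [simp]:
  "word_mult \<sigma> \<delta> [] G = G" "word_mult \<sigma> \<delta> (i # w) G = var_mult \<sigma> \<delta> i (word_mult \<sigma> \<delta> w G)"
  "word_mult \<sigma> \<delta> w 0 = 0"
  by (simp_all add: word_mult_def, induction w) auto

lemma word_mult_add: "word_mult \<sigma> \<delta> w (F + G) = word_mult \<sigma> \<delta> w F + word_mult \<sigma> \<delta> w G"
  by (induction w) (auto simp: var_mult_add)

lemma skew_mult_zero [simp]: "0 \<odot> G = 0" "F \<odot> 0 = 0"
  by (simp_all add: skew_mult_def)

lemma skew_mult_single: "Poly_Mapping.single m c \<odot> G = lscale c (word_mult \<sigma> \<delta> m G)"
  by (cases "c = 0") (simp_all add: skew_mult_def)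

lemma skew_mult_add_left: "(F + F') \<odot> G = F \<odot> G + F' \<odot> G"
  unfolding skew_mult_def
  by (rule setsum_keys_plus_distrib) (simp_all add: lscale_add_left)

lemma skew_mult_add_right: "F \<odot> (G + G') = F \<odot> G + F \<odot> G'"
  by (simp add: skew_mult_def word_mult_add lscale_add sum.distrib)

lemma skew_mult_sum_left: "sum f A \<odot> G = (\<Sum>x\<in>A. f x \<odot> G)"
  by (induction A rule: infinite_finite_induct) (auto simp: skew_mult_add_left)

lemma skew_mult_sum_right: "G \<odot> sum f A = (\<Sum>x\<in>A. G \<odot> f x)"
  by (induction A rule: infinite_finite_induct) (auto simp: skew_mult_add_right)

lemma skew_mult_diff_left: "(F - F') \<odot> G = F \<odot> G - F' \<odot> G"
  using skew_mult_add_left[of "F - F'" F' G] by (simp add: algebra_simps)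

lemma skew_mult_diff_right: "F \<odot> (G - G') = F \<odot> G - F \<odot> G'"
  using skew_mult_add_right[of F "G - G'" G'] by (simp add: algebra_simps)

lemma lscale_skew_mult: "lscale c F \<odot> G = lscale c (F \<odot> G)"
  by (induction F rule: skew_poly_induct)
     (auto simp: skew_mult_single lscale_lscale lscale_add skew_mult_add_left)

lemma var_mult_skew_mult: "var_mult \<sigma> \<delta> i F \<odot> G = var_mult \<sigma> \<delta> i (F \<odot> G)"
  by (induction F rule: skew_poly_induct)
     (auto simp: skew_mult_single var_mult_single var_mult_lscale skew_mult_add_left var_mult_add
        skew_mult_sum_left)

lemma word_mult_skew_mult: "word_mult \<sigma> \<delta> w F \<odot> G = word_mult \<sigma> \<delta> w (F \<odot> G)"
  by (induction w) (auto simp: var_mult_skew_mult)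

theorem skew_mult_assoc: "(F \<odot> G) \<odot> H = F \<odot> (G \<odot> H)"
  by (induction F rule: skew_poly_induct)
     (auto simp: skew_mult_single lscale_skew_mult word_mult_skew_mult skew_mult_add_left)

lemma skew_const_mult: "skew_const c \<odot> F = lscale c F"
  by (simp add: skew_const_def skew_mult_single)

lemma skew_var_mult: "skew_var i \<odot> F = var_mult \<sigma> \<delta> i F"
  by (simp add: skew_var_def skew_mult_single)

lemma word_mult_word: "word_mult \<sigma> \<delta> w (Poly_Mapping.single m 1) = Poly_Mapping.single (w @ m) 1"
proof (induction w)
  case (Cons i w)
  have "(\<Sum>j\<in>UNIV. Poly_Mapping.single (j # w @ m) (mat 1 $ i $ j))
     = (\<Sum>j\<in>UNIV. if j = i then Poly_Mapping.single (i # w @ m) (1 :: 'a) else 0)"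
    by (rule sum.cong) (auto simp: mat_def)
  then show ?case using Cons by (simp add: var_mult_single sigma_delta_simps)
qed simp

theorem skew_mult_words:
  "Poly_Mapping.single w 1 \<odot> Poly_Mapping.single m 1 = Poly_Mapping.single (w @ m) 1"
  by (simp add: skew_mult_single word_mult_word)

theorem skew_mult_one: "skew_const 1 \<odot> F = F" "F \<odot> skew_const 1 = F"
proof -
  show "skew_const 1 \<odot> F = F" by (simp add: skew_const_mult)
  show "F \<odot> skew_const 1 = F"
    by (induction F rule: skew_poly_induct)
       (auto simp: skew_mult_single skew_const_def word_mult_word skew_mult_add_left)
qed

theorem skew_var_const:
  "skew_var i \<odot> skew_const a = (\<Sum>j\<in>UNIV. skew_const (\<sigma> a $ i $ j) \<odot> skew_var j) + skew_const (\<delta> a $ i)"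
  unfolding skew_var_mult skew_const_mult by (simp add: skew_const_def skew_var_def var_mult_single)

private definition bd :: "nat \<Rightarrow> ('a, 'n) skew_poly \<Rightarrow> bool" where
  "bd d F \<longleftrightarrow> (\<forall>m. d \<le> length m \<longrightarrow> coef F m = 0)"

private lemma bd_simps [simp]: "bd d 0" "bd 0 F \<longleftrightarrow> F = 0"
  by (auto simp: bd_def intro: poly_mapping_eqI)

private lemma bd_add: "bd d F \<Longrightarrow> bd d G \<Longrightarrow> bd d (F + G)"
  by (simp add: bd_def lookup_add)

private lemma bd_diff: "bd d F \<Longrightarrow> bd d G \<Longrightarrow> bd d (F - G)"
  by (simp add: bd_def lookup_minus)

private lemma bd_uminus: "bd d F \<Longrightarrow> bd d (- F)"
  by (simp add: bd_def)

private lemma bd_sum: "(\<And>x. x \<in> A \<Longrightarrow> bd d (f x)) \<Longrightarrow> bd d (sum f A)"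
  by (simp add: bd_def lookup_sum)

private lemma bd_lscale: "bd d F \<Longrightarrow> bd d (lscale c F)"
  by (simp add: bd_def coef_lscale)

private lemma bd_single: "length m < d \<Longrightarrow> bd d (Poly_Mapping.single m c)"
  by (auto simp: bd_def lookup_single when_def)

private lemma bd_mono: "bd d F \<Longrightarrow> d \<le> e \<Longrightarrow> bd e F"
  by (simp add: bd_def)

private lemma bd_keys: "bd d F \<Longrightarrow> m \<in> Poly_Mapping.keys F \<Longrightarrow> length m < d"
  by (metis bd_def in_keys_iff not_le)

private lemma bd_ex: "\<exists>d. bd d F"
proof -
  define d where "d = Suc (Max (length ` Poly_Mapping.keys F))"
  have "length m < d" if "coef F m \<noteq> 0" for m
    using that unfolding d_def by (intro le_imp_less_Suc Max_ge) (auto simp: in_keys_iff)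
  then show ?thesis unfolding bd_def by (metis not_le)
qed

private lemma bd_var_mult:
  assumes "bd d F" shows "bd (Suc d) (var_mult \<sigma> \<delta> i F)"
  using bd_keys[OF assms] unfolding var_mult_def
  by (intro bd_sum bd_add bd_single) (auto simp: less_SucI)

private lemma bd_word_mult: "bd d F \<Longrightarrow> bd (length w + d) (word_mult \<sigma> \<delta> w F)"
  by (induction w) (auto intro: bd_var_mult)

private lemma bd_mult_const:
  assumes "bd d F" shows "bd d (F \<odot> skew_const a)"
  unfolding skew_mult_def
proof (intro bd_sum bd_lscale)
  fix m assume "m \<in> Poly_Mapping.keys F"
  then have "length m < d" using bd_keys assms by blast
  moreover have "bd (length m + 1) (word_mult \<sigma> \<delta> m (skew_const a))"
    by (rule bd_word_mult) (simp add: skew_const_def bd_single)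
  ultimately show "bd d (word_mult \<sigma> \<delta> m (skew_const a))" by (auto intro: bd_mono)
qed

private lemma mult_var_single: "Poly_Mapping.single w c \<odot> skew_var i = Poly_Mapping.single (w @ [i]) c"
  by (simp add: skew_mult_single skew_var_def word_mult_word)

private lemma coef_mult_var: "coef (F \<odot> skew_var j) (m @ [i]) = (if i = j then coef F m else 0)"
  by (induction F rule: skew_poly_induct)
     (auto simp: mult_var_single lookup_single when_def skew_mult_add_left lookup_add)

private lemma right_division_exists_bd:
  assumes "bd d F"
  shows "\<exists>D c. F = (\<Sum>i\<in>UNIV. D i \<odot> (skew_var i - skew_const (a $ i))) + skew_const c"
  using assms
proof (induction d arbitrary: F)
  case 0
  then show ?case by (intro exI[of _ "\<lambda>_. 0"] exI[of _ 0]) (simp add: skew_const_def)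
next
  case (Suc d)
  note IH = Suc.IH
  have keys: "length m \<le> d" if "m \<in> Poly_Mapping.keys F" for m
    using bd_keys[OF Suc.prems that] by simp
  show ?case
  proof (induction F rule: skew_poly_induct)
    case zero
    show ?case by (intro exI[of _ "\<lambda>_. 0"] exI[of _ 0]) (simp add: skew_const_def)
  next
    case (single m c)
    show ?case
    proof (cases m rule: rev_cases)
      case Nil
      then show ?thesis by (intro exI[of _ "\<lambda>_. 0"] exI[of _ c]) (simp add: skew_const_def)
    next
      case (snoc w k)
      let ?W = "Poly_Mapping.single w c"
      have "bd d (?W \<odot> skew_const (a $ k))"
        using keys[OF single] snoc by (intro bd_mult_const bd_single) simp
      from IH[OF this] obtain D c' where D: "?W \<odot> skew_const (a $ k) =
          (\<Sum>i\<in>UNIV. D i \<odot> (skew_var i - skew_const (a $ i))) + skew_const c'" by blast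
      have "(\<Sum>i\<in>UNIV. (if i = k then ?W else 0) \<odot> (skew_var i - skew_const (a $ i)))
          = (\<Sum>i\<in>UNIV. if i = k then ?W \<odot> (skew_var k - skew_const (a $ k)) else 0)"
        by (rule sum.cong) auto
      also have "\<dots> = Poly_Mapping.single m c - ?W \<odot> skew_const (a $ k)"
        by (simp add: snoc skew_mult_diff_right mult_var_single)
      finally have "(\<Sum>i\<in>UNIV. (D i + (if i = k then ?W else 0)) \<odot> (skew_var i - skew_const (a $ i)))
             + skew_const c' = Poly_Mapping.single m c"
        unfolding skew_mult_add_left sum.distrib using D by simp
      then show ?thesis
        by (intro exI[of _ "\<lambda>i. D i + (if i = k then ?W else 0)"] exI[of _ c']) (rule sym)
    qed
  next
    case (add F G)
    then obtain D c D' c' where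
      "F = (\<Sum>i\<in>UNIV. D i \<odot> (skew_var i - skew_const (a $ i))) + skew_const c"
      "G = (\<Sum>i\<in>UNIV. D' i \<odot> (skew_var i - skew_const (a $ i))) + skew_const c'" by blast
    then have "F + G = (\<Sum>i\<in>UNIV. (D i + D' i) \<odot> (skew_var i - skew_const (a $ i))) + skew_const (c + c')"
      by (simp add: skew_mult_add_left sum.distrib skew_const_def single_add algebra_simps)
    then show ?case by (intro exI[of _ "\<lambda>i. D i + D' i"] exI[of _ "c + c'"])
  qed
qed

private lemma right_division_zero:
  assumes 0: "(\<Sum>i\<in>UNIV. D i \<odot> (skew_var i - skew_const (a $ i))) + skew_const c = 0"
  shows "D = (\<lambda>_. 0) \<and> c = 0"
proof -
  have eq: "(\<Sum>i\<in>UNIV. D i \<odot> skew_var i) = (\<Sum>i\<in>UNIV. D i \<odot> skew_const (a $ i)) - skew_const c"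
    using 0 by (simp add: skew_mult_diff_right sum_subtractf algebra_simps)
  have step: "\<forall>i. bd d (D i)" if d: "\<forall>i. bd (Suc d) (D i)" for d
  proof (rule allI)
    fix i
    have "coef (D i) m = 0" if m: "length m = d" for m
    proof -
      have "bd (Suc d) (\<Sum>i\<in>UNIV. D i \<odot> skew_const (a $ i))"
        using d by (intro bd_sum bd_mult_const) auto
      then have "coef ((\<Sum>i\<in>UNIV. D i \<odot> skew_const (a $ i)) - skew_const c) (m @ [i]) = 0"
        using m by (simp add: bd_def lookup_minus skew_const_def lookup_single when_def)
      then have "coef (\<Sum>i\<in>UNIV. D i \<odot> skew_var i) (m @ [i]) = 0" by (simp add: eq)
      then show ?thesis by (simp add: lookup_sum coef_mult_var)
    qed
    with d show "bd d (D i)" unfolding bd_def by (metis le_neq_implies_less Suc_leI)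
  qed
  have z: "\<forall>i. D i = 0" if "\<forall>i. bd d (D i)" for d
    using that by (induction d) (use step in auto)
  define d where "d i = (SOME e. bd e (D i))" for i
  have d: "bd (d i) (D i)" for i unfolding d_def by (rule someI_ex[OF bd_ex])
  have "\<forall>i. bd (Max (range d)) (D i)"
    by (auto intro!: bd_mono[OF d])
  then have "D = (\<lambda>_. 0)" using z by auto
  moreover from this 0 have "coef (skew_const c :: ('a, 'n) skew_poly) [] = 0" by simp
  ultimately show ?thesis by (simp add: skew_const_def)
qed

theorem right_division_unique:
  "\<exists>!(D, c). F = (\<Sum>i\<in>UNIV. D i \<odot> (skew_var i - skew_const (a $ i))) + skew_const c"
proof -
  obtain D c where D: "F = (\<Sum>i\<in>UNIV. D i \<odot> (skew_var i - skew_const (a $ i))) + skew_const c"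
    using bd_ex[of F] by (elim exE) (drule right_division_exists_bd, elim exE, blast)
  show ?thesis
  proof (intro ex1I[of _ "(D, c)"], goal_cases)
    case (2 p)
    obtain D' c' where p: "p = (D', c')" by force
    have "(\<Sum>i\<in>UNIV. (D' i - D i) \<odot> (skew_var i - skew_const (a $ i))) + skew_const (c' - c) = 0"
      using 2 D unfolding p skew_mult_diff_left[of "D' _"] sum_subtractf skew_const_def single_diff
      by (simp add: add_diff_eq diff_add_eq diff_diff_eq)
    from right_division_zero[OF this] show ?case by (auto simp: p fun_eq_iff)
  qed (use D in simp)
qed

private lemma coef_var_mult:
  assumes "bd (Suc (length m)) F"
  shows "coef (var_mult \<sigma> \<delta> i F) (k # m) = \<sigma> (coef F m) $ i $ k"
  using assms
proof -
  have *: "coef (var_mult \<sigma> \<delta> i F) (k # m) = \<sigma> (coef F m) $ i $ k + \<delta> (coef F (k # m)) $ i" for F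
  proof (induction F rule: skew_poly_induct)
    case (single w c)
    then show ?case
      by (auto simp: var_mult_single lookup_add lookup_sum lookup_single when_def
          sigma_delta_simps if_distrib cong: if_cong)
  qed (auto simp: var_mult_add lookup_add sigma_delta_simps algebra_simps)
  show ?thesis using assms unfolding * by (simp add: bd_def sigma_delta_simps)
qed

private lemma left_division_exists_bd:
  assumes "bd d F" and bij: "bij (phi \<sigma>)"
  shows "\<exists>D c. F = (\<Sum>i\<in>UNIV. (skew_var i - skew_const (a $ i)) \<odot> D i) + skew_const c"
  using assms(1)
proof (induction d arbitrary: F)
  case 0
  then show ?case by (intro exI[of _ "\<lambda>_. 0"] exI[of _ 0]) (simp add: skew_const_def)
next
  case (Suc d)
  note IH = Suc.IH
  have keys: "length m \<le> d" if "m \<in> Poly_Mapping.keys F" for m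
    using bd_keys[OF Suc.prems that] by simp
  show ?case
  proof (induction F rule: skew_poly_induct)
    case zero
    show ?case by (intro exI[of _ "\<lambda>_. 0"] exI[of _ 0]) (simp add: skew_const_def)
  next
    case (single m c)
    show ?case
    proof (cases m)
      case Nil
      then show ?thesis by (intro exI[of _ "\<lambda>_. 0"] exI[of _ c]) (simp add: skew_const_def)
    next
      case (Cons k w)
      obtain \<gamma> where "axis k c = phi \<sigma> \<gamma>" using bij_is_surj[OF bij] by (rule surjE)
      note \<gamma> = this[symmetric]
      define E where "E i = Poly_Mapping.single w (\<gamma> $ i)" for i
      define L where "L = (\<Sum>i\<in>UNIV. Poly_Mapping.single w (\<delta> (\<gamma> $ i) $ i)) -
                          (\<Sum>i\<in>UNIV. skew_const (a $ i) \<odot> E i)"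
      have w: "length w < d" using keys[OF single] Cons by simp
      have single_sum: "(\<Sum>x\<in>UNIV. Poly_Mapping.single k (f x)) = Poly_Mapping.single k (sum f UNIV)"
        for k :: "'n list" and f :: "'n \<Rightarrow> 'a"
        by (rule poly_mapping_eqI) (auto simp: lookup_sum lookup_single when_def)
      have "(\<Sum>i\<in>UNIV. \<Sum>j\<in>UNIV. Poly_Mapping.single (j # w) (\<sigma> (\<gamma> $ i) $ i $ j))
          = (\<Sum>j\<in>UNIV. \<Sum>i\<in>UNIV. Poly_Mapping.single (j # w) (\<sigma> (\<gamma> $ i) $ i $ j))"
        by (rule sum.swap)
      also have "\<dots> = (\<Sum>j\<in>UNIV. Poly_Mapping.single (j # w) (phi \<sigma> \<gamma> $ j))"
        by (simp add: single_sum phi_def)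
      also have "\<dots> = (\<Sum>j\<in>UNIV. if j = k then Poly_Mapping.single (k # w) c else 0)"
        unfolding \<gamma> by (rule sum.cong) (auto simp: axis_def)
      also have "\<dots> = Poly_Mapping.single m c" by (simp add: Cons)
      finally have E: "(\<Sum>i\<in>UNIV. (skew_var i - skew_const (a $ i)) \<odot> E i) = Poly_Mapping.single m c + L"
        by (simp add: L_def E_def skew_mult_diff_left skew_var_mult var_mult_single sum.distrib
            sum_subtractf)
      have "bd d L" unfolding L_def E_def skew_const_mult
        using w by (intro bd_diff bd_sum bd_lscale bd_single)
      from IH[OF this] obtain D c' where D:
        "L = (\<Sum>i\<in>UNIV. (skew_var i - skew_const (a $ i)) \<odot> D i) + skew_const c'" by blast
      have "Poly_Mapping.single m c
          = (\<Sum>i\<in>UNIV. (skew_var i - skew_const (a $ i)) \<odot> (E i - D i)) + skew_const (- c')"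
        using D E by (simp add: skew_mult_diff_right sum_subtractf skew_const_def single_uminus
            algebra_simps)
      then show ?thesis by (intro exI[of _ "\<lambda>i. E i - D i"] exI[of _ "- c'"])
    qed
  next
    case (add F G)
    then obtain D c D' c' where
      "F = (\<Sum>i\<in>UNIV. (skew_var i - skew_const (a $ i)) \<odot> D i) + skew_const c"
      "G = (\<Sum>i\<in>UNIV. (skew_var i - skew_const (a $ i)) \<odot> D' i) + skew_const c'" by blast
    then have "F + G = (\<Sum>i\<in>UNIV. (skew_var i - skew_const (a $ i)) \<odot> (D i + D' i)) + skew_const (c + c')"
      by (simp add: skew_mult_add_right sum.distrib skew_const_def single_add algebra_simps)
    then show ?case by (intro exI[of _ "\<lambda>i. D i + D' i"] exI[of _ "c + c'"])
  qed
qed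

private lemma left_division_zero:
  assumes 0: "(\<Sum>i\<in>UNIV. (skew_var i - skew_const (a $ i)) \<odot> D i) + skew_const c = 0"
    and bij: "bij (phi \<sigma>)"
  shows "D = (\<lambda>_. 0) \<and> c = 0"
proof -
  have eq: "(\<Sum>i\<in>UNIV. var_mult \<sigma> \<delta> i (D i)) = (\<Sum>i\<in>UNIV. lscale (a $ i) (D i)) - skew_const c"
    using 0 by (simp add: skew_mult_diff_left skew_var_mult skew_const_mult sum_subtractf algebra_simps)
  have step: "\<forall>i. bd d (D i)" if d: "\<forall>i. bd (Suc d) (D i)" for d
  proof -
    have "coef (D i) m = 0" if m: "length m = d" for m i
    proof -
      have "phi \<sigma> (\<chi> i. coef (D i) m) $ k = 0" for k
      proof -
        have "bd (Suc d) (\<Sum>i\<in>UNIV. lscale (a $ i) (D i))"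
          using d by (intro bd_sum bd_lscale) auto
        then have "coef ((\<Sum>i\<in>UNIV. lscale (a $ i) (D i)) - skew_const c) (k # m) = 0"
          using m by (simp add: bd_def lookup_minus skew_const_def lookup_single when_def)
        then have "coef (\<Sum>i\<in>UNIV. var_mult \<sigma> \<delta> i (D i)) (k # m) = 0" by (simp add: eq)
        then show ?thesis using d m by (simp add: lookup_sum coef_var_mult phi_def)
      qed
      moreover have "phi \<sigma> 0 = 0" by (simp add: phi_def sigma_delta_simps vec_eq_iff)
      ultimately have "phi \<sigma> (\<chi> i. coef (D i) m) = phi \<sigma> 0" by (simp add: vec_eq_iff)
      then have "(\<chi> i. coef (D i) m) = 0" using bij by (simp add: bij_def inj_eq)
      then show ?thesis by (simp add: vec_eq_iff)
    qed
    with d show ?thesis unfolding bd_def by (metis le_neq_implies_less Suc_leI)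
  qed
  have z: "\<forall>i. D i = 0" if "\<forall>i. bd d (D i)" for d
    using that by (induction d) (use step in auto)
  define d where "d i = (SOME e. bd e (D i))" for i
  have d: "bd (d i) (D i)" for i unfolding d_def by (rule someI_ex[OF bd_ex])
  have "\<forall>i. bd (Max (range d)) (D i)"
    by (auto intro!: bd_mono[OF d])
  then have "D = (\<lambda>_. 0)" using z by auto
  moreover from this 0 have "coef (skew_const c :: ('a, 'n) skew_poly) [] = 0" by simp
  ultimately show ?thesis by (simp add: skew_const_def)
qed

theorem left_division_unique:
  assumes "bij (phi \<sigma>)"
  shows "\<exists>!(D, c). F = (\<Sum>i\<in>UNIV. (skew_var i - skew_const (a $ i)) \<odot> D i) + skew_const c"
proof -
  obtain D c where D: "F = (\<Sum>i\<in>UNIV. (skew_var i - skew_const (a $ i)) \<odot> D i) + skew_const c"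
    using bd_ex[of F] by (elim exE) (drule left_division_exists_bd[OF _ assms], elim exE, blast)
  show ?thesis
  proof (intro ex1I[of _ "(D, c)"], goal_cases)
    case (2 p)
    obtain D' c' where p: "p = (D', c')" by force
    have "(\<Sum>i\<in>UNIV. (skew_var i - skew_const (a $ i)) \<odot> (D' i - D i)) + skew_const (c' - c) = 0"
      using 2 D unfolding p skew_mult_diff_right[of _ "D' _"] sum_subtractf skew_const_def single_diff
      by (simp add: add_diff_eq diff_add_eq diff_diff_eq)
    from left_division_zero[OF this assms] show ?case by (auto simp: p fun_eq_iff)
  qed (use D in simp)
qed

end

end

theory Submission
  imports Defs
begin

text \<open>
  The \<open>N\<close> conditions are linear functionals \<open>e\<^sub>0, \<dots>, e\<^sub>N\<^sub>-\<^sub>1\<close> on the skew polynomials, listed first by the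
  point and then by the order of the derivative.  Over a division ring their joint image is described
  by its pivots: \<open>k\<close> is a pivot of a submodule if some element of it is killed by all \<open>e\<^sub>l\<close> with \<open>l < k\<close>
  but not by \<open>e\<^sub>k\<close>.  The number of pivots is the dimension of the image, and Gaussian elimination
  (\<open>pivot_elimination\<close>) shows that all values are attained on a submodule on which every \<open>k\<close> is a pivot.

  DP-independence says that for each condition some \<open>F\<close> violates it while it satisfies all conditions at
  the other points and all conditions of lower order at the same point (\<open>DP_indep_iff\<close>).  Such an \<open>F\<close>
  makes the index of that condition a pivot, so DP-independence yields all pivots, and then all values, on the whole ring.
  Conversely, prescribing the value 1 for one condition and 0 for the others gives such an \<open>F\<close>.

  It remains to bound the degree.  The common kernel \<open>I\<close> of the functionals is a left ideal (a right
  ideal for the right version; \<open>ev_cut_mul\<close>): if the remainder of \<open>F\<close> vanishes, then dividing \<open>G F\<close> amounts to multiplying the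
  quotients of \<open>F\<close> by \<open>G\<close>.  Hence, if all polynomials of degree \<open>\<le> d\<close> are congruent modulo \<open>I\<close> to
  polynomials of degree \<open>< d\<close>, the same holds with \<open>d + 1\<close> for \<open>d\<close>, because each monomial of degree
  \<open>d + 1\<close> is a product of one of degree 1 and one of degree \<open>d\<close> (\<open>deg_below_saturated_Suc\<close>).  So the
  dimension of the image of the polynomials of degree \<open>< d\<close> grows strictly with \<open>d\<close> until it is final,
  and it is final for \<open>d = N\<close> at the latest (\<open>all_pivots_deg_below\<close>).

  Finally, interpolation of all values is the same as an isomorphism onto the vectors of length \<open>N\<close>:
  the polynomials interpolating the unit vectors generate a submodule in which every element is
  recovered from its values (\<open>interpolation_iff_module_iso\<close>).
\<close>

section \<open>Skew polynomials of bounded degree\<close>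

definition deg_below :: "nat \<Rightarrow> ('a::zero, 'n) skew_poly set" where
  "deg_below d = {F. \<forall>m\<in>Poly_Mapping.keys F. length m < d}"

lemma skew_deg_less_iff: "skew_deg F < ereal (real d) \<longleftrightarrow> F \<in> deg_below d"
  by (auto simp: skew_deg_def deg_below_def)

lemma zero_in_deg_below [simp]: "0 \<in> deg_below d"
  by (simp add: deg_below_def)

lemma deg_below_add: "F \<in> deg_below d \<Longrightarrow> G \<in> deg_below d \<Longrightarrow> F + G \<in> deg_below d"
  using keys_add[of F G] unfolding deg_below_def by blast

lemma deg_below_sum: "(\<And>x. x \<in> A \<Longrightarrow> f x \<in> deg_below d) \<Longrightarrow> sum f A \<in> deg_below d"
  by (induction A rule: infinite_finite_induct) (auto intro: deg_below_add)

lemma deg_below_mono: "d \<le> e \<Longrightarrow> F \<in> deg_below d \<Longrightarrow> F \<in> deg_below e"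
  by (force simp: deg_below_def)

lemma deg_below_single: "length m < d \<Longrightarrow> Poly_Mapping.single m c \<in> deg_below d"
  by (simp add: deg_below_def)

lemma deg_below_lscale: "F \<in> deg_below d \<Longrightarrow> lscale c F \<in> deg_below d"
  by (auto simp: deg_below_def in_keys_iff coef_lscale)

lemma deg_below_exhaust: "\<exists>d. F \<in> deg_below d"
proof -
  have "\<forall>m\<in>Poly_Mapping.keys F. length m < Suc (Max (length ` Poly_Mapping.keys F))"
    by (simp add: less_Suc_eq_le)
  then show ?thesis by (auto simp: deg_below_def)
qed

text \<open>
  The factors have degree at most \<open>d - 1\<close> and \<open>e - 1\<close>, and moving a coefficient past a variable by
  \<open>x\<^sub>i a = (\<Sum>j. \<sigma>\<^sub>i\<^sub>j(a) x\<^sub>j) + \<delta>\<^sub>i(a)\<close> does not raise the degree.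
\<close>

lemma deg_below_skew_mult:
  assumes "matrix_ring_hom \<sigma>" "vector_derivation \<sigma> \<delta>" "F \<in> deg_below d" "G \<in> deg_below e"
  shows "skew_mult \<sigma> \<delta> F G \<in> deg_below (d + e - 1)"
proof -
  have var: "var_mult \<sigma> \<delta> i H \<in> deg_below (Suc k)" if "H \<in> deg_below k" for i H k
    using that unfolding var_mult_def deg_below_def[of k]
    by (intro deg_below_sum deg_below_add deg_below_single) (auto simp: less_SucI)
  have word: "word_mult \<sigma> \<delta> w G \<in> deg_below (length w + e)" for w
    by (induction w) (simp_all add: assms var word_mult_def)
  have "word_mult \<sigma> \<delta> m G \<in> deg_below (d + e - 1)" if "m \<in> Poly_Mapping.keys F" for m
    using that assms(3) by (intro deg_below_mono[OF _ word]) (force simp: deg_below_def)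
  then show ?thesis
    unfolding skew_mult_def by (intro deg_below_sum deg_below_lscale)
qed

section \<open>The conditions in their order\<close>

definition nodes :: "'n list list \<Rightarrow> (nat \<times> nat) list" where
  "nodes ms = concat (map (\<lambda>j. map (Pair j) [0..<Suc (length (ms ! j))]) [0..<length ms])"

lemma set_nodes: "set (nodes ms) = {(j, i). j < length ms \<and> i \<le> length (ms ! j)}"
  by (auto simp: nodes_def simp del: upt_Suc)

lemma length_nodes: "length (nodes ms) = (\<Sum>j<length ms. length (ms ! j) + 1)"
  by (simp add: nodes_def length_concat comp_def interv_sum_list_conv_sum_set_nat atLeast0LessThan)

text \<open>
  Every condition preceding a given one belongs to another point or is of lower order at the same
  point.  These are the conditions that DP-independence controls.
\<close>

lemma sorted_nodes: "sorted_wrt (\<lambda>(j, i) (j', i'). j \<noteq> j' \<or> i < i') (nodes ms)"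
proof -
  have "sorted_wrt (\<lambda>(j, i) (j', i'). j \<noteq> j' \<or> i < i')
      (concat (map (\<lambda>j. map (Pair j) [0..<f j]) js))" if "distinct js" for f :: "nat \<Rightarrow> nat" and js :: "nat list"
    using that
    by (induction js) (auto simp: sorted_wrt_append sorted_wrt_map)
  from this[of "[0..<length ms]"] show ?thesis by (simp only: nodes_def distinct_upt)
qed

lemma distinct_nodes: "distinct (nodes ms)"
proof -
  have "nodes ms ! k \<noteq> nodes ms ! l" if "k < l" "l < length (nodes ms)" for k l
    using sorted_wrt_nth_less[OF sorted_nodes that] by auto
  then show ?thesis by (metis distinct_conv_nth nat_neq_iff)
qed

section \<open>Division by the variables and ideals of vanishing\<close>

text \<open>
  The left and the right version are the same statement about opposite rings: \<open>mul\<close> is the product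
  \<open>F \<odot> G\<close> or the product \<open>G \<odot> F\<close>, and \<open>mlt\<close> the corresponding product of the division ring, so that
  a left ideal for \<open>mul\<close>, and division with the quotients to the left, cover both cases.  In a word,
  the letter whose quotient is taken first stands at the end for one version and at the beginning
  for the other; \<open>reading\<close> lists the letters in the order in which the quotients are taken, and
  \<open>cut i\<close> keeps the first \<open>i\<close> of them.
\<close>

locale skew_interpolation =
  fixes mul :: "('a::division_ring, 'n::finite) skew_poly \<Rightarrow> ('a, 'n) skew_poly \<Rightarrow> ('a, 'n) skew_poly"
    and mlt :: "'a \<Rightarrow> 'a \<Rightarrow> 'a"
    and reading :: "'n list \<Rightarrow> 'n list"
    and cut :: "nat \<Rightarrow> 'n list \<Rightarrow> 'n list"
  assumes mul_add_left: "mul (F + F') G = mul F G + mul F' G"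
    and mul_add_right: "mul F (G + G') = mul F G + mul F G'"
    and mul_assoc: "mul (mul F G) H = mul F (mul G H)"
    and mul_one: "mul (skew_const 1) F = F"
    and mul_const: "mul (skew_const b) (skew_const c) = skew_const (mlt b c)"
    and mlt_cases: "mlt = (*) \<or> mlt = (\<lambda>b c. c * b)"
    and deg_below_mul: "F \<in> deg_below d \<Longrightarrow> G \<in> deg_below e \<Longrightarrow> mul F G \<in> deg_below (d + e - 1)"
    and single_factor: "m \<noteq> [] \<Longrightarrow>
      \<exists>G\<in>deg_below 2. \<exists>F\<in>deg_below (length m). Poly_Mapping.single m c = mul G F"
    and division_unique:
      "\<exists>!(D, c). F = (\<Sum>i\<in>UNIV. mul (D i) (skew_var i - skew_const (a $ i))) + skew_const c"
    and reading_cut: "reading (cut i w) = take i (reading w)"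
    and length_reading: "length (reading w) = length w"
begin

definition division :: "'a ^ 'n \<Rightarrow> ('a, 'n) skew_poly \<Rightarrow> ('n \<Rightarrow> ('a, 'n) skew_poly) \<times> 'a" where
  "division a F =
     (THE (D, c). F = (\<Sum>i\<in>UNIV. mul (D i) (skew_var i - skew_const (a $ i))) + skew_const c)"

text \<open>
  This is the value at \<open>a\<close> of the derivative along \<open>w\<close>.
\<close>

definition ev :: "'a ^ 'n \<Rightarrow> 'n list \<Rightarrow> ('a, 'n) skew_poly \<Rightarrow> 'a" where
  "ev a w F = snd (division a (fold (\<lambda>i G. fst (division a G) i) (reading w) F))"

abbreviation act :: "'a \<Rightarrow> ('a, 'n) skew_poly \<Rightarrow> ('a, 'n) skew_poly" where
  "act c F \<equiv> mul (skew_const c) F"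

lemma mlt_simps [simp]: "mlt c 0 = 0" "mlt c 1 = c"
  using mlt_cases by auto

lemma mlt_solve:
  assumes "v \<noteq> 0" obtains c where "mlt c v = b"
proof -
  from mlt_cases show ?thesis
  proof
    assume "mlt = (*)"
    with assms show ?thesis by (intro that[of "b * inverse v"]) (simp add: mult.assoc)
  next
    assume "mlt = (\<lambda>b c. c * b)"
    with assms show ?thesis by (intro that[of "inverse v * b"]) (simp add: mult.assoc[symmetric])
  qed
qed

lemma mul_zero [simp]: "mul 0 F = 0" "mul F 0 = 0"
  using mul_add_left[of 0 0 F] mul_add_right[of F 0 0] by simp_all

lemma mul_sum_right: "mul F (sum g A) = (\<Sum>x\<in>A. mul F (g x))"
  by (induction A rule: infinite_finite_induct) (simp_all add: mul_add_right)

lemma act_zero [simp]: "act 0 F = 0"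
  by (simp add: skew_const_def)

lemma act_add: "act (c + d) F = act c F + act d F"
  by (simp add: skew_const_def single_add mul_add_left)

lemma act_act: "act c (act d F) = act (mlt c d) F"
  by (simp add: mul_assoc[symmetric] mul_const)

lemma act_minus_one: "act (- 1) F = - F"
  using act_add[of 1 "- 1" F] by (simp add: mul_one eq_neg_iff_add_eq_0 add.commute)

lemma division_eqI:
  assumes "F = (\<Sum>i\<in>UNIV. mul (D i) (skew_var i - skew_const (a $ i))) + skew_const c"
  shows "division a F = (D, c)"
  unfolding division_def
  by (rule the1_equality[OF division_unique]) (use assms in simp)

lemma division_eq:
  "F = (\<Sum>i\<in>UNIV. mul (fst (division a F) i) (skew_var i - skew_const (a $ i)))
     + skew_const (snd (division a F))"
proof -
  obtain D c where F: "F = (\<Sum>i\<in>UNIV. mul (D i) (skew_var i - skew_const (a $ i))) + skew_const c"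
    using division_unique[of F a] by blast
  from division_eqI[OF this] F show ?thesis by simp
qed

lemma division_add:
  "division a (F + G) = (\<lambda>i. fst (division a F) i + fst (division a G) i,
                         snd (division a F) + snd (division a G))"
proof (rule division_eqI)
  have "F + G = ((\<Sum>i\<in>UNIV. mul (fst (division a F) i) (skew_var i - skew_const (a $ i)))
         + skew_const (snd (division a F)))
       + ((\<Sum>i\<in>UNIV. mul (fst (division a G) i) (skew_var i - skew_const (a $ i)))
         + skew_const (snd (division a G)))"
    by (simp only: division_eq[symmetric])
  then show "F + G = (\<Sum>i\<in>UNIV. mul (fst (division a F) i + fst (division a G) i)
           (skew_var i - skew_const (a $ i)))
         + skew_const (snd (division a F) + snd (division a G))"
    by (simp add: mul_add_left sum.distrib skew_const_def single_add algebra_simps)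
qed

lemma division_act:
  "division a (act c F) = (\<lambda>i. act c (fst (division a F) i), mlt c (snd (division a F)))"
  by (rule division_eqI, subst division_eq[of F a])
     (simp add: mul_add_right mul_sum_right mul_assoc mul_const)

text \<open>
  The product of \<open>G\<close> with a nonzero remainder would have to be divided again.  Without a remainder,
  multiplying the division identity of \<open>F\<close> by \<open>G\<close> gives the division identity of the product.
\<close>

lemma division_mul:
  assumes "snd (division a F) = 0"
  shows "division a (mul G F) = (\<lambda>i. mul G (fst (division a F) i), 0)"
  by (rule division_eqI, subst division_eq[of F a])
     (simp add: assms mul_add_right mul_sum_right mul_assoc skew_const_def)

lemma ev_add: "ev a w (F + G) = ev a w F + ev a w G"
proof -
  have "fold (\<lambda>i G. fst (division a G) i) u (F + G)
      = fold (\<lambda>i G. fst (division a G) i) u F + fold (\<lambda>i G. fst (division a G) i) u G" for u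
    by (induction u arbitrary: F G) (simp_all add: division_add)
  then show ?thesis by (simp add: ev_def division_add)
qed

lemma ev_act: "ev a w (act c F) = mlt c (ev a w F)"
proof -
  have "fold (\<lambda>i G. fst (division a G) i) u (act c F)
      = act c (fold (\<lambda>i G. fst (division a G) i) u F)" for u
    by (induction u arbitrary: F) (simp_all add: division_act)
  then show ?thesis by (simp add: ev_def division_act)
qed

text \<open>
  The common kernel of the evaluations along the beginnings of a word is an ideal: since all earlier
  remainders vanish, the factor \<open>G\<close> is carried along through all quotients.
\<close>

lemma ev_cut_mul:
  assumes "\<forall>i\<le>length w. ev a (cut i w) F = 0" "i \<le> length w"
  shows "ev a (cut i w) (mul G F) = 0"
proof -
  let ?d = "\<lambda>u. fold (\<lambda>i G. fst (division a G) i) u"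
  have "snd (division a (?d u (mul G F))) = 0"
    if "\<forall>i\<le>length u. snd (division a (?d (take i u) F)) = 0" for u
    using that
  proof (induction u arbitrary: F)
    case Nil
    then show ?case by (simp add: division_mul)
  next
    case (Cons x u)
    from Cons.prems[rule_format, of 0] have 0: "snd (division a F) = 0" by simp
    have "\<forall>i\<le>length u. snd (division a (?d (take i u) (fst (division a F) x))) = 0"
      using Cons.prems by (auto dest: spec[of _ "Suc _"])
    from Cons.IH[OF this] show ?case by (simp add: division_mul[OF 0])
  qed
  from this[of "take i (reading w)"] assms show ?thesis
    by (auto simp: ev_def reading_cut length_reading min_def)
qed

lemma ev_cut_cut: "i \<le> j \<Longrightarrow> ev a (cut i (cut j w)) = ev a (cut i w)"
  by (simp add: ev_def fun_eq_iff reading_cut min_absorb1)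

lemma length_cut: "length (cut i w) = min i (length w)"
  using length_reading[of "cut i w"] length_reading[of w] by (simp add: reading_cut min.commute)

section \<open>DP-independence as a triangular system\<close>

definition submodule :: "('a, 'n) skew_poly set \<Rightarrow> bool" where
  "submodule S \<longleftrightarrow> 0 \<in> S \<and> (\<forall>F\<in>S. \<forall>G\<in>S. F + G \<in> S) \<and> (\<forall>c. \<forall>F\<in>S. act c F \<in> S)"

definition module_iso ::
  "nat \<Rightarrow> ('a, 'n) skew_poly set \<Rightarrow> (('a, 'n) skew_poly \<Rightarrow> 'a list) \<Rightarrow> bool" where
  "module_iso N S f \<longleftrightarrow>
     bij_betw f S {v. length v = N} \<and>
     (\<forall>F\<in>S. \<forall>G\<in>S. f (F + G) = map2 (+) (f F) (f G)) \<and>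
     (\<forall>c. \<forall>F\<in>S. f (act c F) = map (mlt c) (f F))"

definition vanish :: "'n list list \<Rightarrow> ('a ^ 'n) list \<Rightarrow> ('a, 'n) skew_poly set" where
  "vanish ms ps = {F. \<forall>j<length ps. \<forall>i\<le>length (ms ! j). ev (ps ! j) (cut i (ms ! j)) F = 0}"

definition DP_indep_from :: "'n list list \<Rightarrow> 'n list \<Rightarrow> 'a ^ 'n \<Rightarrow> ('a ^ 'n) list \<Rightarrow> bool" where
  "DP_indep_from ms m a ps \<longleftrightarrow>
     a \<notin> set ps \<and>
     vanish (ms @ [cut 0 m]) (ps @ [a]) \<subset> vanish ms ps \<and>
     (\<forall>i<length m. vanish (ms @ [cut (Suc i) m]) (ps @ [a]) \<subset> vanish (ms @ [cut i m]) (ps @ [a]))"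

definition DP_indep :: "'n list list \<Rightarrow> ('a ^ 'n) list \<Rightarrow> bool" where
  "DP_indep ms ps \<longleftrightarrow>
     (\<forall>j<length ps. DP_indep_from (delete_nth j ms) (ms ! j) (ps ! j) (delete_nth j ps))"

definition psi :: "'n list list \<Rightarrow> ('a ^ 'n) list \<Rightarrow> ('a, 'n) skew_poly \<Rightarrow> 'a list" where
  "psi ms ps F = concat (map (\<lambda>j. map (\<lambda>i. ev (ps ! j) (cut i (ms ! j)) F)
     [0..<Suc (length (ms ! j))]) [0..<length ps])"

lemma submodule_diff: "submodule S \<Longrightarrow> F \<in> S \<Longrightarrow> G \<in> S \<Longrightarrow> F - G \<in> S"
  unfolding submodule_def using act_minus_one[of G]
  by (metis add_uminus_conv_diff)

lemma submodule_sum: "submodule S \<Longrightarrow> (\<And>x. x \<in> A \<Longrightarrow> f x \<in> S) \<Longrightarrow> sum f A \<in> S"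
  by (induction A rule: infinite_finite_induct) (auto simp: submodule_def)

lemma submodule_deg_below: "submodule (deg_below d)"
proof -
  have "act c F \<in> deg_below d" if "F \<in> deg_below d" for c F
    using deg_below_mul[OF deg_below_single[of "[]" 1 c] that] by (simp add: skew_const_def)
  then show ?thesis by (simp add: submodule_def deg_below_add)
qed

lemma submodule_hull: "submodule (submodule hull A)"
  by (rule hull_in) (auto simp: submodule_def)

lemma vanish_snoc:
  assumes "length ms = length ps"
  shows "vanish (ms @ [m]) (ps @ [a])
       = {F \<in> vanish ms ps. \<forall>i\<le>length m. ev a (cut i m) F = 0}"
  using assms by (auto simp: vanish_def nth_append less_Suc_eq)

lemma vanish_delete_nth:
  assumes "length ms = length ps" "j < length ps"
  shows "vanish (delete_nth j ms) (delete_nth j ps)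
       = {F. \<forall>k<length ps. k \<noteq> j \<longrightarrow> (\<forall>i\<le>length (ms ! k). ev (ps ! k) (cut i (ms ! k)) F = 0)}"
    (is "?L = {F. \<forall>k<length ps. k \<noteq> j \<longrightarrow> ?P F k}")
proof -
  have nth: "delete_nth j xs ! k = xs ! (if k < j then k else Suc k)"
    if "length xs = length ps" "k < length ps - 1" for k and xs :: "'b list"
    using that assms by (auto simp: delete_nth_def nth_append min_def)
  have len: "length (delete_nth j ps) = length ps - 1"
    using assms by (simp add: delete_nth_def min_def)
  have shift: "F \<in> ?L \<longleftrightarrow> (\<forall>k<length ps - 1. ?P F (if k < j then k else Suc k))" for F
    by (simp add: vanish_def len nth assms)
  have skip: "(\<forall>k<length ps - 1. Q (if k < j then k else Suc k)) \<longleftrightarrow>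
      (\<forall>k<length ps. k \<noteq> j \<longrightarrow> Q k)" (is "?A \<longleftrightarrow> ?B") for Q
  proof
    assume A: ?A
    show ?B
    proof (intro allI impI)
      fix k assume k: "k < length ps" "k \<noteq> j"
      show "Q k"
      proof (cases "k < j")
        case True
        then show ?thesis using A[rule_format, of k] assms(2) by simp
      next
        case False
        then have "j < k" "\<not> k - 1 < j" using k(2) by auto
        then show ?thesis using A[rule_format, of "k - 1"] k(1) by simp
      qed
    qed
  next
    assume B: ?B
    show ?A using B assms(2) by auto
  qed
  show ?thesis
    by (rule set_eqI) (simp only: shift skip[of "?P _"] mem_Collect_eq)
qed

lemma not_in_delete_nth: "distinct xs \<Longrightarrow> j < length xs \<Longrightarrow> xs ! j \<notin> set (delete_nth j xs)"
  using id_take_nth_drop[of j xs] distinct_append[of "take j xs" "xs ! j # drop (Suc j) xs"]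
  by (auto simp: delete_nth_def)

text \<open>
  Each member of the chain is cut out of the previous one by a single condition, so strictness means
  that the condition does not follow from those imposed before.
\<close>

lemma DP_indep_iff:
  assumes len: "length ms = length ps" and "distinct ps"
  shows "DP_indep ms ps \<longleftrightarrow> (\<forall>j<length ps. \<forall>i\<le>length (ms ! j). \<exists>F.
     ev (ps ! j) (cut i (ms ! j)) F \<noteq> 0 \<and> (\<forall>i'<i. ev (ps ! j) (cut i' (ms ! j)) F = 0) \<and>
     (\<forall>k<length ps. k \<noteq> j \<longrightarrow> (\<forall>i\<le>length (ms ! k). ev (ps ! k) (cut i (ms ! k)) F = 0)))"
proof -
  have "DP_indep_from (delete_nth j ms) (ms ! j) (ps ! j) (delete_nth j ps) \<longleftrightarrow>
     (\<forall>i\<le>length (ms ! j). \<exists>F. ev (ps ! j) (cut i (ms ! j)) F \<noteq> 0 \<and>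
        (\<forall>i'<i. ev (ps ! j) (cut i' (ms ! j)) F = 0) \<and> F \<in> vanish (delete_nth j ms) (delete_nth j ps))"
    if j: "j < length ps" for j
  proof -
    define I where "I = vanish (delete_nth j ms) (delete_nth j ps)"
    define e where "e i = ev (ps ! j) (cut i (ms ! j))" for i
    \<comment> \<open>Cutting a cut word again gives back the shorter cuts, so only the conditions of order at most \<open>i\<close> remain.\<close>
    have I: "vanish (delete_nth j ms @ [cut i (ms ! j)]) (delete_nth j ps @ [ps ! j])
        = {F \<in> I. \<forall>i'\<le>i. e i' F = 0}" if "i \<le> length (ms ! j)" for i
    proof -
      have "length (delete_nth j ms) = length (delete_nth j ps)"
        using len by (simp add: delete_nth_def)
      from vanish_snoc[OF this] that show ?thesis
        by (simp add: I_def e_def length_cut ev_cut_cut min_absorb1 cong: conj_cong)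
    qed
    have "{F \<in> I. e 0 F = 0} \<subset> I \<longleftrightarrow> (\<exists>F. e 0 F \<noteq> 0 \<and> F \<in> I)" by auto
    moreover have "{F \<in> I. \<forall>i'\<le>Suc i. e i' F = 0} \<subset> {F \<in> I. \<forall>i'\<le>i. e i' F = 0} \<longleftrightarrow>
        (\<exists>F. e (Suc i) F \<noteq> 0 \<and> (\<forall>i'<Suc i. e i' F = 0) \<and> F \<in> I)" for i
      by (auto simp: psubset_eq le_Suc_eq less_Suc_eq_le)
    ultimately have "DP_indep_from (delete_nth j ms) (ms ! j) (ps ! j) (delete_nth j ps) \<longleftrightarrow>
        (\<exists>F. e 0 F \<noteq> 0 \<and> F \<in> I) \<and> (\<forall>i<length (ms ! j).
          \<exists>F. e (Suc i) F \<noteq> 0 \<and> (\<forall>i'<Suc i. e i' F = 0) \<and> F \<in> I)"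
      using not_in_delete_nth[OF assms(2) j]
      by (simp add: DP_indep_from_def I I_def[symmetric])
    also have "\<dots> \<longleftrightarrow>
        (\<forall>i<Suc (length (ms ! j)). \<exists>F. e i F \<noteq> 0 \<and> (\<forall>i'<i. e i' F = 0) \<and> F \<in> I)"
      by (subst All_less_Suc2) simp
    finally show ?thesis by (simp add: e_def I_def less_Suc_eq_le)
  qed
  then show ?thesis
    by (simp add: DP_indep_def vanish_delete_nth[OF len])
qed

section \<open>Pivots\<close>

text \<open>
  For the images under \<open>e\<close> these are the pivot columns of an echelon basis.  Counting them replaces a
  dimension theory for vector spaces over a division ring.
\<close>

definition pivots :: "(nat \<Rightarrow> ('a, 'n) skew_poly \<Rightarrow> 'a) \<Rightarrow> nat \<Rightarrow> ('a, 'n) skew_poly set \<Rightarrow> nat set" where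
  "pivots e N W = {k. k < N \<and> (\<exists>F\<in>W. e k F \<noteq> 0 \<and> (\<forall>l<k. e l F = 0))}"

definition linear_functional :: "(('a, 'n) skew_poly \<Rightarrow> 'a) \<Rightarrow> bool" where
  "linear_functional f \<longleftrightarrow> (\<forall>F G. f (F + G) = f F + f G) \<and> (\<forall>c F. f (act c F) = mlt c (f F))"

lemma linear_functional_simps:
  assumes "linear_functional f"
  shows "f (F + G) = f F + f G" "f (act c F) = mlt c (f F)" "f 0 = 0" "f (F - G) = f F - f G"
    "f (sum g A) = (\<Sum>x\<in>A. f (g x))"
proof -
  show add: "f (F + G) = f F + f G" "f (act c F) = mlt c (f F)" for F G c
    using assms by (auto simp: linear_functional_def)
  show 0: "f 0 = 0" using add(1)[of 0 0] by simp
  show "f (F - G) = f F - f G" using add(1)[of "F - G" G] by simp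
  show "f (sum g A) = (\<Sum>x\<in>A. f (g x))"
    by (induction A rule: infinite_finite_induct) (simp_all add: 0 add)
qed

lemma finite_pivots [simp]: "finite (pivots e N W)"
  by (simp add: pivots_def)

lemma pivots_mono: "V \<subseteq> W \<Longrightarrow> pivots e N V \<subseteq> pivots e N W"
  by (auto simp: pivots_def)

lemma pivots_subset: "pivots e N W \<subseteq> {..<N}"
  by (auto simp: pivots_def)

text \<open>
  Gaussian elimination: the values are corrected one after the other, a pivot element allowing to
  change the value of \<open>e n\<close> without affecting the earlier ones.  A pivot is demanded only where a
  correction is necessary, which serves both for arbitrary values and for values known to come from a
  larger submodule.
\<close>

lemma pivot_elimination:
  assumes lin: "\<And>k. linear_functional (e k)" and W: "submodule W"
    and pivot: "\<And>n G. n < N \<Longrightarrow> G \<in> W \<Longrightarrow> \<forall>k<n. e k G = b k \<Longrightarrow> e n G \<noteq> b n \<Longrightarrow> n \<in> pivots e N W"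
  shows "\<exists>G\<in>W. \<forall>k<N. e k G = b k"
proof -
  note [simp] = linear_functional_simps[OF lin]
  have "\<exists>G\<in>W. \<forall>k<n. e k G = b k" if "n \<le> N" for n
    using that
  proof (induction n)
    case 0
    then show ?case using W by (auto simp: submodule_def)
  next
    case (Suc n)
    then obtain G where G: "G \<in> W" "\<forall>k<n. e k G = b k" by auto
    show ?case
    proof (cases "e n G = b n")
      case True
      with G show ?thesis by (auto simp: less_Suc_eq)
    next
      case False
      then have "n \<in> pivots e N W" using pivot G Suc.prems by simp
      then obtain H where H: "H \<in> W" "e n H \<noteq> 0" "\<forall>l<n. e l H = 0" by (auto simp: pivots_def)
      obtain c where c: "mlt c (e n H) = b n - e n G" using mlt_solve[OF H(2)] by blast
      have "G + act c H \<in> W" using G H W by (auto simp: submodule_def)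
      moreover have "\<forall>k<Suc n. e k (G + act c H) = b k"
        using G H by (auto simp: less_Suc_eq c)
      ultimately show ?thesis by blast
    qed
  qed
  then show ?thesis by blast
qed

lemma interpolation_if_all_pivots:
  assumes "\<And>k. linear_functional (e k)" "submodule W" "pivots e N W = {..<N}"
  shows "\<exists>G\<in>W. \<forall>k<N. e k G = b k"
  by (rule pivot_elimination) (use assms in auto)

text \<open>
  Two nested submodules with the same pivots have the same image.  Here a correction at \<open>n\<close> is needed
  only if \<open>F - G\<close> itself exhibits \<open>n\<close> as a pivot of the larger one.
\<close>

lemma same_values_if_pivots_subset:
  assumes lin: "\<And>k. linear_functional (e k)" and W: "submodule W" and V: "submodule V"
    and sub: "W \<subseteq> V" and piv: "pivots e N V \<subseteq> pivots e N W" and F: "F \<in> V"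
  shows "\<exists>G\<in>W. \<forall>k<N. e k G = e k F"
proof (rule pivot_elimination[OF lin W])
  fix n G
  assume n: "n < N" and G: "G \<in> W" "\<forall>k<n. e k G = e k F" "e n G \<noteq> e n F"
  have "F - G \<in> V" using submodule_diff[OF V F] G(1) sub by blast
  with n G have "n \<in> pivots e N V"
    by (auto simp: pivots_def linear_functional_simps[OF lin] intro!: bexI[of _ "F - G"])
  with piv show "n \<in> pivots e N W" by blast
qed

section \<open>The degree bound\<close>

lemma deg_below_mul_left:
  assumes "G \<in> deg_below 2" "F \<in> deg_below d" shows "mul G F \<in> deg_below (Suc d)"
  using deg_below_mul[OF assms] by simp

text \<open>
  A monomial of degree at most \<open>d + 1\<close> is constant or a product of a polynomial of degree at most 1 and
  some \<open>H\<close> of degree at most \<open>d\<close>.  Replacing \<open>H\<close> by a polynomial \<open>K\<close> with the same values and of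
  degree below \<open>d\<close> changes the product only by an element of the common kernel, which is an ideal.
\<close>

lemma deg_below_saturated_Suc:
  assumes lin: "\<And>k. linear_functional (e k)"
    and ideal: "\<And>F G. \<forall>k<N. e k F = 0 \<Longrightarrow> \<forall>k<N. e k (mul G F) = 0"
    and sat: "\<forall>F\<in>deg_below (Suc d). \<exists>G\<in>deg_below d. \<forall>k<N. e k G = e k F"
    and F: "F \<in> deg_below (Suc (Suc d))"
  shows "\<exists>G\<in>deg_below (Suc d). \<forall>k<N. e k G = e k F"
proof (induction F rule: skew_poly_induct)
  case zero
  show ?case by (auto intro: bexI[of _ 0])
next
  case (single m c)
  then have m: "length m \<le> Suc d" using F by (auto simp: deg_below_def)
  show ?case
  proof (cases "m = []")
    case True
    then show ?thesis by (intro bexI[of _ "Poly_Mapping.single m c"]) (simp_all add: deg_below_single)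
  next
    case False
    then obtain G H where GH: "G \<in> deg_below 2" "H \<in> deg_below (length m)"
      "Poly_Mapping.single m c = mul G H" using single_factor by blast
    then have "H \<in> deg_below (Suc d)" using m deg_below_mono by blast
    then obtain K where K: "K \<in> deg_below d" "\<forall>k<N. e k K = e k H" using sat by blast
    have "\<forall>k<N. e k (mul G (H - K)) = 0"
      by (rule ideal) (simp add: linear_functional_simps[OF lin] K)
    moreover have "mul G H = mul G K + mul G (H - K)" by (simp add: mul_add_right[symmetric])
    ultimately have "\<forall>k<N. e k (mul G K) = e k (mul G H)"
      by (simp add: linear_functional_simps(1)[OF lin])
    with deg_below_mul_left[OF GH(1) K(1)] GH(3) show ?thesis by auto
  qed
next
  case (add F G)
  then obtain F' G' where "F' \<in> deg_below (Suc d)" "\<forall>k<N. e k F' = e k F"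
    "G' \<in> deg_below (Suc d)" "\<forall>k<N. e k G' = e k G" by blast
  then show ?case
    by (intro bexI[of _ "F' + G'"]) (simp_all add: linear_functional_simps[OF lin] deg_below_add)
qed

text \<open>
  The pivots of the polynomials of degree below \<open>d\<close> become strictly more with each \<open>d\<close> until they stop
  growing; once they stop, saturation shows that higher degrees contribute nothing, so all \<open>N\<close> pivots
  are present.  Therefore at least \<open>min d N\<close> of them are present in degree below \<open>d\<close>.
\<close>

lemma all_pivots_deg_below:
  assumes lin: "\<And>k. linear_functional (e k)"
    and ideal: "\<And>F G. \<forall>k<N. e k F = 0 \<Longrightarrow> \<forall>k<N. e k (mul G F) = 0"
    and all: "pivots e N UNIV = {..<N}"
  shows "pivots e N (deg_below N) = {..<N}"
proof -
  let ?P = "\<lambda>d. pivots e N (deg_below d)"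
  have step: "?P d = {..<N}" if eq: "?P (Suc d) = ?P d" for d
  proof -
    have base: "\<forall>F\<in>deg_below (Suc d). \<exists>G\<in>deg_below d. \<forall>k<N. e k G = e k F"
      by (intro ballI same_values_if_pivots_subset[OF lin submodule_deg_below submodule_deg_below])
         (use eq in \<open>auto intro: deg_below_mono[OF le_SucI]\<close>)
    have sat: "\<forall>F\<in>deg_below (Suc (d + t)). \<exists>G\<in>deg_below (d + t). \<forall>k<N. e k G = e k F" for t
      by (induction t) (use base deg_below_saturated_Suc[OF lin ideal] in auto)
    have low: "\<forall>F\<in>deg_below (d + t). \<exists>G\<in>deg_below d. \<forall>k<N. e k G = e k F" for t
    proof (induction t)
      case (Suc t)
      then show ?case using sat[of t] by (metis add_Suc_right)
    qed auto
    have "k \<in> ?P d" if k: "k < N" for k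
    proof -
      from k all obtain F where F: "e k F \<noteq> 0" "\<forall>l<k. e l F = 0" by (auto simp: pivots_def)
      obtain t where "F \<in> deg_below t" using deg_below_exhaust by blast
      then have "F \<in> deg_below (d + t)" by (rule deg_below_mono[rotated]) simp
      then obtain G where "G \<in> deg_below d" "\<forall>k<N. e k G = e k F" using low by blast
      with F k show ?thesis by (auto simp: pivots_def intro!: bexI[of _ G])
    qed
    then show ?thesis using pivots_subset by blast
  qed
  have card: "min d N \<le> card (?P d)" for d
  proof (induction d)
    case (Suc d)
    have sub: "?P d \<subseteq> ?P (Suc d)" by (intro pivots_mono) (auto intro: deg_below_mono[OF le_SucI])
    show ?case
    proof (cases "?P (Suc d) = ?P d")
      case True
      then show ?thesis using step[OF True] by simp
    next
      case False
      then have "card (?P d) < card (?P (Suc d))" using sub by (intro psubset_card_mono) auto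
      with Suc show ?thesis by simp
    qed
  qed simp
  then show ?thesis using card[of N] pivots_subset[of e N "deg_below N"]
    by (intro card_subset_eq) (auto intro: antisym card_mono[of "{..<N}", simplified])
qed

section \<open>Interpolation and isomorphisms\<close>

text \<open>
  For the polynomials \<open>B k\<close> interpolating the unit vectors, the \<open>F\<close> with
  \<open>F = (\<Sum>k<N. act (e k F) (B k))\<close> form a submodule containing all \<open>B k\<close>, hence containing the
  generated one; so an element generated by the \<open>B k\<close> is determined by its values.
\<close>

lemma interpolation_iff_module_iso:
  assumes lin: "\<And>k. linear_functional (e k)" and W: "submodule W"
  shows "(\<forall>b. \<exists>F\<in>W. \<forall>k<N. e k F = b k) \<longleftrightarrow>
    (\<exists>Fs. length Fs = N \<and> set Fs \<subseteq> W \<and> module_iso N (submodule hull set Fs) (\<lambda>F. map (\<lambda>k. e k F) [0..<N]))"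
    (is "?L \<longleftrightarrow> (\<exists>Fs. _ \<and> _ \<and> module_iso N _ ?psi)")
proof
  assume L: ?L
  have "\<exists>F. F \<in> W \<and> (\<forall>l<N. e l F = (if l = k then 1 else 0))" for k
    using spec[OF L, of "\<lambda>l. if l = k then 1 else 0"] by (simp only: Bex_def)
  then have "\<exists>B. \<forall>k. B k \<in> W \<and> (\<forall>l<N. e l (B k) = (if l = k then 1 else 0))"
    by (intro choice allI)
  then obtain B where B: "\<And>k. B k \<in> W" "\<And>k l. l < N \<Longrightarrow> e l (B k) = (if l = k then 1 else 0)"
    by auto
  define Fs where "Fs = map B [0..<N]"
  define expand where "expand v = (\<Sum>k<N. act (v k) (B k))" for v
  have e_expand: "e l (expand v) = v l" if "l < N" for v l
    using that by (simp add: expand_def linear_functional_simps[OF lin] B if_distrib cong: if_cong)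
  let ?T = "{F. F = expand (\<lambda>k. e k F)}"
  have "submodule ?T"
    unfolding submodule_def
  proof (intro conjI ballI allI; clarsimp)
    show "expand (\<lambda>k. e k 0) = 0" by (simp add: expand_def linear_functional_simps[OF lin])
  next
    fix F G assume "F = expand (\<lambda>k. e k F)" "G = expand (\<lambda>k. e k G)"
    then show "F + G = expand (\<lambda>k. e k (F + G))"
      by (simp add: expand_def linear_functional_simps[OF lin] act_add sum.distrib)
  next
    fix c F assume "F = expand (\<lambda>k. e k F)"
    then have "act c F = act c (expand (\<lambda>k. e k F))" by simp
    also have "\<dots> = expand (\<lambda>k. e k (act c F))"
      by (simp add: expand_def linear_functional_simps[OF lin] mul_sum_right act_act)
    finally show "act c F = expand (\<lambda>k. e k (act c F))" .
  qed
  moreover have "set Fs \<subseteq> ?T"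
  proof
    fix F assume "F \<in> set Fs"
    then obtain n where n: "n < N" "F = B n" by (auto simp: Fs_def)
    have "expand (\<lambda>k. e k (B n)) = (\<Sum>k<N. if k = n then B k else 0)"
      unfolding expand_def by (rule sum.cong) (simp_all add: B mul_one)
    with n show "F \<in> ?T" by simp
  qed
  ultimately have T: "submodule hull set Fs \<subseteq> ?T" by (intro hull_minimal)
  have "inj_on ?psi (submodule hull set Fs)"
  proof (rule inj_onI)
    fix F G assume "F \<in> submodule hull set Fs" "G \<in> submodule hull set Fs" "?psi F = ?psi G"
    then have "F = expand (\<lambda>k. e k F)" "G = expand (\<lambda>k. e k G)" "\<forall>k<N. e k F = e k G"
      using T by (auto simp: list_eq_iff_nth_eq)
    moreover from this(3) have "expand (\<lambda>k. e k F) = expand (\<lambda>k. e k G)"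
      by (simp add: expand_def)
    ultimately show "F = G" by simp
  qed
  moreover have "?psi ` (submodule hull set Fs) = {v. length v = N}"
  proof (intro set_eqI iffI)
    fix v :: "'a list" assume v: "v \<in> {v. length v = N}"
    have "B k \<in> submodule hull set Fs" if "k < N" for k
      using that by (intro hull_inc) (simp add: Fs_def)
    then have "expand (\<lambda>k. v ! k) \<in> submodule hull set Fs"
      unfolding expand_def using submodule_hull[of "set Fs"]
      by (intro submodule_sum) (auto simp: submodule_def)
    moreover have "?psi (expand (\<lambda>k. v ! k)) = v"
      using v by (auto simp: list_eq_iff_nth_eq e_expand)
    ultimately show "v \<in> ?psi ` (submodule hull set Fs)" by (metis image_eqI)
  qed auto
  ultimately have "bij_betw ?psi (submodule hull set Fs) {v. length v = N}"
    by (simp add: bij_betw_def)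
  then have "module_iso N (submodule hull set Fs) ?psi"
    by (auto simp: module_iso_def list_eq_iff_nth_eq linear_functional_simps[OF lin])
  moreover have "length Fs = N" "set Fs \<subseteq> W" using B by (auto simp: Fs_def)
  ultimately show "\<exists>Fs. length Fs = N \<and> set Fs \<subseteq> W \<and> module_iso N (submodule hull set Fs) ?psi"
    by blast
next
  assume "\<exists>Fs. length Fs = N \<and> set Fs \<subseteq> W \<and> module_iso N (submodule hull set Fs) ?psi"
  then obtain Fs where Fs: "set Fs \<subseteq> W" "module_iso N (submodule hull set Fs) ?psi" by blast
  have hull: "submodule hull set Fs \<subseteq> W" by (rule hull_minimal) (use Fs W in auto)
  show ?L
  proof
    fix b
    have "map b [0..<N] \<in> ?psi ` (submodule hull set Fs)"
      using Fs(2) by (simp add: module_iso_def bij_betw_def)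
    then obtain F where "F \<in> W" "map b [0..<N] = ?psi F" using hull by blast
    then show "\<exists>F\<in>W. \<forall>k<N. e k F = b k" by (auto simp: list_eq_iff_nth_eq)
  qed
qed

theorem DP_indep_interpolation:
  assumes len: "length ms = length ps" and dist: "distinct ps"
    and N: "N = (\<Sum>j<length ps. length (ms ! j) + 1)"
  shows "DP_indep ms ps \<longleftrightarrow> (\<exists>Fs. length Fs = N \<and> (\<forall>F\<in>set Fs. skew_deg F < ereal (real N)) \<and>
           module_iso N (submodule hull set Fs) (psi ms ps))" (is "?one \<longleftrightarrow> ?two")
    and "DP_indep ms ps \<longleftrightarrow> (\<forall>b :: nat \<Rightarrow> nat \<Rightarrow> 'a. \<exists>F. skew_deg F < ereal (real N) \<and>
           (\<forall>j<length ps. \<forall>i\<le>length (ms ! j). ev (ps ! j) (cut i (ms ! j)) F = b j i))"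
      (is "_ \<longleftrightarrow> ?three")
proof -
  define E where "E = (\<lambda>(j, i). ev (ps ! j) (cut i (ms ! j)))"
  define e where "e k = E (nodes ms ! k)" for k
  have lenN: "length (nodes ms) = N" by (simp add: length_nodes N len)
  have lin: "linear_functional (e k)" for k
    by (auto simp: linear_functional_def e_def E_def ev_add ev_act split: prod.splits)
  have all_nodes: "(\<forall>k<N. Q (nodes ms ! k)) \<longleftrightarrow> (\<forall>j<length ps. \<forall>i\<le>length (ms ! j). Q (j, i))" for Q
    using set_nodes[of ms] all_set_conv_all_nth[of "nodes ms" Q] by (auto simp: lenN len)
  have psi: "psi ms ps = (\<lambda>F. map (\<lambda>k. e k F) [0..<N])"
  proof
    fix F
    have "psi ms ps F = map (\<lambda>p. E p F) (nodes ms)"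
      by (simp add: psi_def nodes_def map_concat comp_def E_def len)
    also have "\<dots> = map (\<lambda>k. e k F) [0..<N]"
      by (auto simp: list_eq_iff_nth_eq e_def lenN)
    finally show "psi ms ps F = map (\<lambda>k. e k F) [0..<N]" .
  qed
  have ideal: "\<forall>k<N. e k (mul G F) = 0" if "\<forall>k<N. e k F = 0" for F G
  proof -
    have "\<forall>j<length ps. \<forall>i\<le>length (ms ! j). E (j, i) F = 0"
      using that unfolding e_def by (subst (asm) all_nodes)
    then have "\<forall>j<length ps. \<forall>i\<le>length (ms ! j). E (j, i) (mul G F) = 0"
      by (auto simp: E_def intro: ev_cut_mul)
    then show ?thesis unfolding e_def by (subst all_nodes)
  qed
  have three: "?three \<longleftrightarrow> (\<forall>b. \<exists>F\<in>deg_below N. \<forall>k<N. e k F = b k)"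
  proof
    assume ?three
    show "\<forall>b. \<exists>F\<in>deg_below N. \<forall>k<N. e k F = b k"
    proof
      fix b :: "nat \<Rightarrow> 'a"
      \<comment> \<open>The values are indexed by position in the list of nodes on one side and by point and order on the other.\<close>
      define b' where "b' j i = b (THE k. k < N \<and> nodes ms ! k = (j, i))" for j i
      have b': "case_prod b' (nodes ms ! k) = b k" if "k < N" for k
      proof -
        have "(THE k'. k' < N \<and> nodes ms ! k' = nodes ms ! k) = k"
          using that distinct_nodes[of ms] by (auto simp: lenN nth_eq_iff_index_eq)
        then show ?thesis by (cases "nodes ms ! k") (simp add: b'_def)
      qed
      obtain F where F: "skew_deg F < ereal (real N)"
        "\<forall>j<length ps. \<forall>i\<le>length (ms ! j). E (j, i) F = case_prod b' (j, i)"
        using spec[OF \<open>?three\<close>, of b'] by (auto simp: E_def)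
      from F(2) have "\<forall>k<N. E (nodes ms ! k) F = case_prod b' (nodes ms ! k)"
        by (subst all_nodes)
      with F(1) b' show "\<exists>F\<in>deg_below N. \<forall>k<N. e k F = b k"
        by (auto simp: skew_deg_less_iff e_def)
    qed
  next
    assume R: "\<forall>b. \<exists>F\<in>deg_below N. \<forall>k<N. e k F = b k"
    show ?three
    proof
      fix b :: "nat \<Rightarrow> nat \<Rightarrow> 'a"
      obtain F where F: "F \<in> deg_below N" "\<forall>k<N. E (nodes ms ! k) F = case_prod b (nodes ms ! k)"
        using R[rule_format, of "\<lambda>k. case_prod b (nodes ms ! k)"] by (auto simp: e_def)
      from F(2) have "\<forall>j<length ps. \<forall>i\<le>length (ms ! j). E (j, i) F = case_prod b (j, i)"
        by (subst (asm) all_nodes)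
      with F(1) show "\<exists>F. skew_deg F < ereal (real N) \<and>
           (\<forall>j<length ps. \<forall>i\<le>length (ms ! j). ev (ps ! j) (cut i (ms ! j)) F = b j i)"
        by (auto simp: skew_deg_less_iff E_def)
    qed
  qed
  have two_three: "?two \<longleftrightarrow> ?three"
    unfolding three interpolation_iff_module_iso[OF lin submodule_deg_below] psi
    by (simp add: skew_deg_less_iff subset_eq)
  have "?three" if ?one
  proof -
    have "k \<in> pivots e N UNIV" if k: "k < N" for k
    proof -
      obtain j i where ji: "nodes ms ! k = (j, i)" by force
      then have "(j, i) \<in> set (nodes ms)" using k lenN nth_mem by metis
      then have "j < length ps" "i \<le> length (ms ! j)" by (auto simp: set_nodes len)
      from \<open>?one\<close>[unfolded DP_indep_iff[OF len dist], rule_format, OF this] obtain F where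
        F: "E (j, i) F \<noteq> 0" "\<forall>i'<i. E (j, i') F = 0"
        "\<forall>j'<length ps. j' \<noteq> j \<longrightarrow> (\<forall>i'\<le>length (ms ! j'). E (j', i') F = 0)"
        by (auto simp: E_def)
      have "e l F = 0" if l: "l < k" for l
      proof -
        obtain j' i' where ji': "nodes ms ! l = (j', i')" by force
        then have "(j', i') \<in> set (nodes ms)" using k l lenN nth_mem by (metis less_trans)
        then have "j' < length ps" "i' \<le> length (ms ! j')" by (auto simp: set_nodes len)
        moreover have "j' \<noteq> j \<or> i' < i"
          using sorted_wrt_nth_less[OF sorted_nodes[of ms] l] k by (simp add: lenN ji ji')
        ultimately show ?thesis using F by (auto simp: e_def ji')
      qed
      with F(1) k show ?thesis by (auto simp: pivots_def e_def ji)
    qed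
    then have "pivots e N UNIV = {..<N}" using pivots_subset by blast
    from interpolation_if_all_pivots[OF lin submodule_deg_below all_pivots_deg_below[OF lin ideal this]]
    show ?three unfolding three by (rule allI)
  qed
  moreover have ?one if ?three
    unfolding DP_indep_iff[OF len dist]
  proof (intro allI impI)
    fix j i assume ji: "j < length ps" "i \<le> length (ms ! j)"
    from spec[OF \<open>?three\<close>, of "\<lambda>j' i'. if (j', i') = (j, i) then 1 else 0"]
    obtain F where F: "\<forall>j'<length ps. \<forall>i'\<le>length (ms ! j').
        ev (ps ! j') (cut i' (ms ! j')) F = (if (j', i') = (j, i) then 1 else 0)"
      by (elim exE conjE)
    with ji show "\<exists>F. ev (ps ! j) (cut i (ms ! j)) F \<noteq> 0 \<and>
       (\<forall>i'<i. ev (ps ! j) (cut i' (ms ! j)) F = 0) \<and>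
       (\<forall>k<length ps. k \<noteq> j \<longrightarrow> (\<forall>i\<le>length (ms ! k). ev (ps ! k) (cut i (ms ! k)) F = 0))"
      by (intro exI[of _ F]) auto
  qed
  ultimately show "?one \<longleftrightarrow> ?three" by blast
  with two_three show "?one \<longleftrightarrow> ?two" by blast
qed

end

section \<open>The two sides\<close>

text \<open>
  Right derivatives take the last letter of a word first, hence words are read backwards.
\<close>

lemma skew_interpolation_left:
  assumes hom: "matrix_ring_hom \<sigma>" and der: "vector_derivation \<sigma> \<delta>"
  shows "skew_interpolation (skew_mult \<sigma> \<delta>) (*) rev word_suffix"
proof unfold_locales
  show "\<exists>!(D, c). F = (\<Sum>i\<in>UNIV. skew_mult \<sigma> \<delta> (D i) (skew_var i - skew_const (a $ i))) + skew_const c"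
    for F a by (rule right_division_unique[OF hom der])
  show "\<exists>G\<in>deg_below 2. \<exists>F\<in>deg_below (length m). Poly_Mapping.single m c = skew_mult \<sigma> \<delta> G F"
    if "m \<noteq> []" for m c
  proof -
    from that obtain i w where m: "m = i # w" by (cases m) auto
    have "Poly_Mapping.single m c = skew_mult \<sigma> \<delta> (Poly_Mapping.single [i] c) (Poly_Mapping.single w 1)"
      using word_mult_word[OF hom der, of "[i]" w]
      by (simp add: m skew_mult_single[OF hom der])
    then show ?thesis
      by (intro bexI[of _ "Poly_Mapping.single [i] c"] bexI[of _ "Poly_Mapping.single w 1"])
         (simp_all add: m deg_below_single)
  qed
  show "rev (word_suffix i w) = take i (rev w)" for i w
    by (simp add: word_suffix_def take_rev)
  show "skew_mult \<sigma> \<delta> F G \<in> deg_below (d + e - 1)" if "F \<in> deg_below d" "G \<in> deg_below e" for F G d e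
    by (rule deg_below_skew_mult[OF hom der that])
qed (simp_all add: assms skew_mult_add_left skew_mult_add_right skew_mult_assoc skew_mult_one
    skew_const_mult, simp_all add: skew_const_def)

text \<open>
  This is the opposite ring.  Bijectivity of \<open>phi \<sigma>\<close> enters through division: the leading
  coefficients of the quotients are found by solving an equation \<open>phi \<sigma> \<gamma> = c\<close>.
\<close>

lemma skew_interpolation_right:
  assumes hom: "matrix_ring_hom \<sigma>" and der: "vector_derivation \<sigma> \<delta>" and bij: "bij (phi \<sigma>)"
  shows "skew_interpolation (\<lambda>G F. skew_mult \<sigma> \<delta> F G) (\<lambda>b c. c * b) id word_prefix"
proof unfold_locales
  show "\<exists>!(D, c). F = (\<Sum>i\<in>UNIV. skew_mult \<sigma> \<delta> (skew_var i - skew_const (a $ i)) (D i)) + skew_const c"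
    for F a by (rule left_division_unique[OF hom der bij])
  show "\<exists>G\<in>deg_below 2. \<exists>F\<in>deg_below (length m). Poly_Mapping.single m c = skew_mult \<sigma> \<delta> F G"
    if "m \<noteq> []" for m c
  proof -
    from that obtain i w where m: "m = w @ [i]" by (cases m rule: rev_cases) auto
    have "Poly_Mapping.single m c = skew_mult \<sigma> \<delta> (Poly_Mapping.single w c) (Poly_Mapping.single [i] 1)"
      by (simp add: m skew_mult_single[OF hom der] word_mult_word[OF hom der])
    then show ?thesis
      by (intro bexI[of _ "Poly_Mapping.single [i] 1"] bexI[of _ "Poly_Mapping.single w c"])
         (simp_all add: m deg_below_single)
  qed
  show "skew_mult \<sigma> \<delta> G F \<in> deg_below (d + e - 1)" if "F \<in> deg_below d" "G \<in> deg_below e" for F G d e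
    using deg_below_skew_mult[OF hom der that(2,1)] by (simp add: add.commute)
qed (simp_all add: assms skew_mult_add_left skew_mult_add_right skew_mult_assoc skew_mult_one
    skew_const_mult word_prefix_def, simp_all add: skew_const_def)

theorem theorem3p15:
  fixes \<sigma> :: "'a::division_ring \<Rightarrow> 'a ^ 'n::finite ^ 'n"
    and \<delta> :: "'a \<Rightarrow> 'a ^ 'n"
    and ps :: "('a ^ 'n) list"
    and ms :: "'n list list"
    and N :: nat
  assumes "matrix_ring_hom \<sigma>"
    and "vector_derivation \<sigma> \<delta>"
    and "length ps \<ge> 1"
    and "distinct ps"
    and "length ms = length ps"
    and "N = (\<Sum>j<length ps. length (ms ! j) + 1)"
  shows
    "((left_DP_indep \<sigma> \<delta> ms ps \<longleftrightarrow>
        (\<exists>Fs. length Fs = N \<and> (\<forall>F\<in>set Fs. skew_deg F < ereal (real N)) \<and>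
           left_module_iso \<sigma> \<delta> N (left_submodule \<sigma> \<delta> hull set Fs) (psi_left \<sigma> \<delta> ms ps))) \<and>
      (left_DP_indep \<sigma> \<delta> ms ps \<longleftrightarrow>
        (\<forall>b :: nat \<Rightarrow> nat \<Rightarrow> 'a. \<exists>F. skew_deg F < ereal (real N) \<and>
           (\<forall>j<length ps. \<forall>i\<le>length (ms ! j).
              right_eval \<sigma> \<delta> (right_deriv \<sigma> \<delta> (ps ! j) (word_suffix i (ms ! j)) F) (ps ! j)
                = b j i))))
     \<and>
     (additive_iso (phi \<sigma>) \<longrightarrow>
      (right_DP_indep \<sigma> \<delta> ms ps \<longleftrightarrow>
        (\<exists>Fs. length Fs = N \<and> (\<forall>F\<in>set Fs. skew_deg F < ereal (real N)) \<and>
           right_module_iso \<sigma> \<delta> N (right_submodule \<sigma> \<delta> hull set Fs) (psi_right \<sigma> \<delta> ms ps))) \<and>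
      (right_DP_indep \<sigma> \<delta> ms ps \<longleftrightarrow>
        (\<forall>b :: nat \<Rightarrow> nat \<Rightarrow> 'a. \<exists>F. skew_deg F < ereal (real N) \<and>
           (\<forall>j<length ps. \<forall>i\<le>length (ms ! j).
              left_eval \<sigma> \<delta> (left_deriv \<sigma> \<delta> (ps ! j) (word_prefix i (ms ! j)) F) (ps ! j)
                = b j i))))"
proof (intro conjI impI)
  interpret L: skew_interpolation "skew_mult \<sigma> \<delta>" "(*)" rev word_suffix
    by (rule skew_interpolation_left[OF assms(1,2)])
  have ev: "right_eval \<sigma> \<delta> (right_deriv \<sigma> \<delta> a w F) a = L.ev a w F" for a w F
    by (simp add: L.ev_def L.division_def right_eval_def right_deriv_def right_division_def foldr_conv_fold)
  have vanish: "vanish_left \<sigma> \<delta> = L.vanish"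
    by (simp add: fun_eq_iff vanish_left_def L.vanish_def ev)
  have DP: "left_DP_indep \<sigma> \<delta> = L.DP_indep"
    by (simp add: fun_eq_iff left_DP_indep_def L.DP_indep_def left_DP_indep_from_def L.DP_indep_from_def vanish)
  have module: "left_submodule \<sigma> \<delta> = L.submodule" "left_module_iso \<sigma> \<delta> = L.module_iso"
    "psi_left \<sigma> \<delta> = L.psi"
    by (simp_all add: fun_eq_iff left_submodule_def L.submodule_def left_module_iso_def
        L.module_iso_def psi_left_def L.psi_def ev)
  note equiv = L.DP_indep_interpolation[OF assms(5,4,6)]
  show "left_DP_indep \<sigma> \<delta> ms ps \<longleftrightarrow>
        (\<exists>Fs. length Fs = N \<and> (\<forall>F\<in>set Fs. skew_deg F < ereal (real N)) \<and>
           left_module_iso \<sigma> \<delta> N (left_submodule \<sigma> \<delta> hull set Fs) (psi_left \<sigma> \<delta> ms ps))"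
    unfolding DP module by (rule equiv(1))
  show "left_DP_indep \<sigma> \<delta> ms ps \<longleftrightarrow>
        (\<forall>b :: nat \<Rightarrow> nat \<Rightarrow> 'a. \<exists>F. skew_deg F < ereal (real N) \<and>
           (\<forall>j<length ps. \<forall>i\<le>length (ms ! j).
              right_eval \<sigma> \<delta> (right_deriv \<sigma> \<delta> (ps ! j) (word_suffix i (ms ! j)) F) (ps ! j)
                = b j i))"
    unfolding DP ev by (rule equiv(2))
next
  assume "additive_iso (phi \<sigma>)"
  then have "bij (phi \<sigma>)" by (simp add: additive_iso_def)
  then interpret R: skew_interpolation "\<lambda>G F. skew_mult \<sigma> \<delta> F G" "\<lambda>b c. c * b" id word_prefix
    by (rule skew_interpolation_right[OF assms(1,2)])
  have ev: "left_eval \<sigma> \<delta> (left_deriv \<sigma> \<delta> a w F) a = R.ev a w F" for a w F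
    by (simp add: R.ev_def R.division_def left_eval_def left_deriv_def left_division_def)
  have vanish: "vanish_right \<sigma> \<delta> = R.vanish"
    by (simp add: fun_eq_iff vanish_right_def R.vanish_def ev)
  have DP: "right_DP_indep \<sigma> \<delta> = R.DP_indep"
    by (simp add: fun_eq_iff right_DP_indep_def R.DP_indep_def right_DP_indep_from_def R.DP_indep_from_def vanish)
  have module: "right_submodule \<sigma> \<delta> = R.submodule" "right_module_iso \<sigma> \<delta> = R.module_iso"
    "psi_right \<sigma> \<delta> = R.psi"
    by (simp_all add: fun_eq_iff right_submodule_def R.submodule_def right_module_iso_def
        R.module_iso_def psi_right_def R.psi_def ev)
  note equiv = R.DP_indep_interpolation[OF assms(5,4,6)]
  show "right_DP_indep \<sigma> \<delta> ms ps \<longleftrightarrow>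
        (\<exists>Fs. length Fs = N \<and> (\<forall>F\<in>set Fs. skew_deg F < ereal (real N)) \<and>
           right_module_iso \<sigma> \<delta> N (right_submodule \<sigma> \<delta> hull set Fs) (psi_right \<sigma> \<delta> ms ps))"
    unfolding DP module by (rule equiv(1))
  show "right_DP_indep \<sigma> \<delta> ms ps \<longleftrightarrow>
        (\<forall>b :: nat \<Rightarrow> nat \<Rightarrow> 'a. \<exists>F. skew_deg F < ereal (real N) \<and>
           (\<forall>j<length ps. \<forall>i\<le>length (ms ! j).
              left_eval \<sigma> \<delta> (left_deriv \<sigma> \<delta> (ps ! j) (word_prefix i (ms ! j)) F) (ps ! j)
                = b j i))"
    unfolding DP ev by (rule equiv(2))
qed

end
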